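(* Let $X$ be a (nonempty) compact Hausdorff space, $\alpha:X\to X$ continuous, $A:C(X)\to C(X)$ a transfer operator for $(X,\alpha)$, and let $Y\subset X$ be a (closed, forward $\alpha$-invariant) subset such that $A$ is $Y$-compatible. Then $$\tau(\mu)=\tau_Y(\mu)\qquad\text{for all }\mu\in M_\alpha(Y).$$ Moreover, if $A$ is $X_\alpha$-compatible, then $$\tau(\mu)=\tau_{X_\alpha}(\mu)\qquad\text{for all }\mu\in M_\alpha(X).$$
   Context: A transfer operator for $(X,\alpha)$ is a positive linear operator $A:C(X)\to C(X)$ with $A((f\circ\alpha)g)=f\,Ag$ for all $f,g\in C(X)$. $M_\alpha(X)$ is the set of regular Borel $\alpha$-invariant probability measures on $X$; write $\mu[f]=\int f\,d\mu$. Essential set: $x\in X$ is essential if for every neighborhood $V$ of $x$ there is $\mu\in M_\alpha(X)$ with $\mu(V)>0$; $X_\alpha$ is the (closed) set of all essential points. It satisfies $\alpha(X_\alpha)=X_\alpha$, and every $\mu\in M_\alpha(X)$ is supported in $X_\alpha$, so $M_\alpha(X)=M_\alpha(X_\alpha)$. Trace: for $x\in X$ let $\nu_x$ be the regular Borel measure (possibly $0$) with $\int f\,d\nu_x=[Af](x)$ for $f\in C(X)$; its support lies in $\alpha^{-1}(x)$. For a closed set $Y$ with $\alpha(Y)\subset Y$ (forward $\alpha$-invariant), $A$ is called $Y$-compatible if for every $f\in C(Y)$ the function $x\mapsto\int_Y f\,d\nu_x$ is continuous on $Y$. In that case $[A_Yf](x):=\int_Y f\,d\nu_x$ ($f\in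 C(Y)$, $x\in Y$) defines a transfer operator $A_Y:C(Y)\to C(Y)$ for $(Y,\alpha|_Y)$. $M_\alpha(Y)$ is the set of regular Borel $\alpha$-invariant probability measures on $Y$, viewed as a subset of $M_\alpha(X)$ by setting $\mu(X\setminus Y)=0$. $t$-entropy: for $\mu\in M_\alpha(X)$, $$\tau(\mu):=\inf_{n\in\mathbb N}\frac1n\inf_G\sum_{g\in G}\mu[g]\ln\frac{\mu[A^ng]}{\mu[g]},$$ where $G$ runs over all (finite) continuous partitions of unity in $C(X)$ by nonnegative functions, a summand with $\mu[g]=0$ is set equal to $0$, and $\ln 0=-\infty$. For $\mu\in M_\alpha(Y)$, $\tau_Y(\mu)$ is given by the same formula with $Y$, $A_Y$ in place of $X$, $A$. *)

theory Defs
  imports "HOL-Probability.Probability"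
begin

section \<open>Real continuous functions and transfer operators\<close>

text \<open>
  A compact Hausdorff space is an abstract topology \<open>X\<close>, and its function space consists of
  functions on the whole ambient type whose values outside \<^term>\<open>topspace X\<close> are irrelevant.
  All equations and inequalities between such functions are therefore required on
  \<^term>\<open>topspace X\<close> only.
\<close>

definition C_space :: "'a topology \<Rightarrow> ('a \<Rightarrow> real) set" where
  "C_space X = {f. continuous_map X euclideanreal f}"

definition positive_linear_operator ::
    "'a topology \<Rightarrow> (('a \<Rightarrow> real) \<Rightarrow> 'a \<Rightarrow> real) \<Rightarrow> bool" where
  "positive_linear_operator X A \<longleftrightarrow>
     (\<forall>f\<in>C_space X. A f \<in> C_space X) \<and>
     (\<forall>f\<in>C_space X. \<forall>g\<in>C_space X. \<forall>x\<in>topspace X. A (\<lambda>y. f y + g y) x = A f x + A g x) \<and>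
     (\<forall>c. \<forall>f\<in>C_space X. \<forall>x\<in>topspace X. A (\<lambda>y. c * f y) x = c * A f x) \<and>
     (\<forall>f\<in>C_space X. (\<forall>x\<in>topspace X. 0 \<le> f x) \<longrightarrow> (\<forall>x\<in>topspace X. 0 \<le> A f x))"

definition transfer_operator ::
    "'a topology \<Rightarrow> ('a \<Rightarrow> 'a) \<Rightarrow> (('a \<Rightarrow> real) \<Rightarrow> 'a \<Rightarrow> real) \<Rightarrow> bool" where
  "transfer_operator X \<alpha> A \<longleftrightarrow>
     positive_linear_operator X A \<and>
     (\<forall>f\<in>C_space X. \<forall>g\<in>C_space X. \<forall>x\<in>topspace X. A (\<lambda>y. f (\<alpha> y) * g y) x = f x * A g x)"

text \<open>
  Positivity and linearity already force \<open>A f\<close> to depend only on the values of \<open>f\<close> on the space,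
  so such an \<open>A\<close> is an operator on the genuine function space.
\<close>

lemma positive_linear_operator_cong:
  assumes A: "positive_linear_operator X A" and f: "f \<in> C_space X" and g: "g \<in> C_space X"
    and eq: "\<And>x. x \<in> topspace X \<Longrightarrow> f x = g x" and x: "x \<in> topspace X"
  shows "A f x = A g x"
proof -
  have add: "A (\<lambda>y. u y + v y) x = A u x + A v x"
    and scale: "A (\<lambda>y. c * u y) x = c * A u x"
    if "u \<in> C_space X" "v \<in> C_space X" for u v c
    using A that x unfolding positive_linear_operator_def by simp_all
  have *: "A u x \<le> A v x" if u: "u \<in> C_space X" and v: "v \<in> C_space X"
    and uv: "\<And>y. y \<in> topspace X \<Longrightarrow> u y = v y" for u v
  proof -
    have m: "(\<lambda>y. (-1) * u y) \<in> C_space X"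
      using u by (auto simp: C_space_def intro!: continuous_intros)
    have d: "(\<lambda>y. v y + (-1) * u y) \<in> C_space X"
      using m v unfolding C_space_def by (auto intro!: continuous_intros)
    have "0 \<le> A (\<lambda>y. v y + (-1) * u y) x"
      using A d x uv unfolding positive_linear_operator_def by auto
    also have "\<dots> = A v x + A (\<lambda>y. (-1) * u y) x"
      by (rule add[OF v m])
    also have "A (\<lambda>y. (-1) * u y) x = (-1) * A u x"
      by (rule scale[OF u u])
    finally show ?thesis by simp
  qed
  show ?thesis using *[OF f g] *[OF g f] eq by (simp add: order_antisym)
qed

section \<open>Regular Borel measures and invariant measures\<close>

definition borel_of :: "'a topology \<Rightarrow> 'a measure" where
  "borel_of X = sigma (topspace X) {U. openin X U}"

definition regular_borel_measure :: "'a topology \<Rightarrow> 'a measure \<Rightarrow> bool" where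
  "regular_borel_measure X \<mu> \<longleftrightarrow>
     sets \<mu> = sets (borel_of X) \<and> finite_measure \<mu> \<and>
     (\<forall>B\<in>sets \<mu>.
        emeasure \<mu> B = (INF U\<in>{U. openin X U \<and> B \<subseteq> U}. emeasure \<mu> U) \<and>
        emeasure \<mu> B = (SUP K\<in>{K. compactin X K \<and> K \<subseteq> B}. emeasure \<mu> K))"

definition invariant_measures :: "'a topology \<Rightarrow> ('a \<Rightarrow> 'a) \<Rightarrow> 'a measure set" where
  "invariant_measures X \<alpha> = {\<mu>. regular_borel_measure X \<mu> \<and> prob_space \<mu> \<and>
     (\<forall>B\<in>sets \<mu>. emeasure \<mu> (\<alpha> -` B \<inter> topspace X) = emeasure \<mu> B)}"

text \<open>
  A measure on a subspace, viewed as a measure on \<open>X\<close> vanishing off the subspace. The opposite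
  passage, for a measure on \<open>X\<close> carried by a closed set, is \<^const>\<open>restrict_space\<close>.
\<close>

definition extend_measure_to :: "'a topology \<Rightarrow> 'a measure \<Rightarrow> 'a measure" where
  "extend_measure_to X \<mu> = distr \<mu> (borel_of X) (\<lambda>x. x)"

definition essential_set :: "'a topology \<Rightarrow> ('a \<Rightarrow> 'a) \<Rightarrow> 'a set" where
  "essential_set X \<alpha> = {x \<in> topspace X.
     \<forall>V. openin X V \<and> x \<in> V \<longrightarrow> (\<exists>\<mu>\<in>invariant_measures X \<alpha>. emeasure \<mu> V > 0)}"

section \<open>Traces of a transfer operator\<close>

text \<open>
  For \<open>X\<close> compact Hausdorff and \<open>A\<close> positive, the Riesz representation theorem provides exactly
  one measure with the property below, so the choice is immaterial.
\<close>

definition representing_measure ::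
    "'a topology \<Rightarrow> (('a \<Rightarrow> real) \<Rightarrow> 'a \<Rightarrow> real) \<Rightarrow> 'a \<Rightarrow> 'a measure" where
  "representing_measure X A x =
     (SOME \<nu>. regular_borel_measure X \<nu> \<and> (\<forall>f\<in>C_space X. (LINT y|\<nu>. f y) = A f x))"

definition trace_operator ::
    "'a topology \<Rightarrow> (('a \<Rightarrow> real) \<Rightarrow> 'a \<Rightarrow> real) \<Rightarrow> 'a set \<Rightarrow> ('a \<Rightarrow> real) \<Rightarrow> 'a \<Rightarrow> real" where
  "trace_operator X A Y f x = (LINT y:Y|representing_measure X A x. f y)"

definition compatible ::
    "'a topology \<Rightarrow> (('a \<Rightarrow> real) \<Rightarrow> 'a \<Rightarrow> real) \<Rightarrow> 'a set \<Rightarrow> bool" where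
  "compatible X A Y \<longleftrightarrow>
     (\<forall>f\<in>C_space (subtopology X Y). trace_operator X A Y f \<in> C_space (subtopology X Y))"

section \<open>The t-entropy\<close>

text \<open>
  Partitions of unity are finite families \<open>g 0, \<dots>, g (k - 1)\<close>. Members may coincide, which does
  not change the infimum below: merging equal members \<open>g\<close> into one multiple of \<open>g\<close> leaves the
  sum unchanged.
\<close>

definition partition_of_unity :: "'a topology \<Rightarrow> nat \<Rightarrow> (nat \<Rightarrow> 'a \<Rightarrow> real) \<Rightarrow> bool" where
  "partition_of_unity X k g \<longleftrightarrow>
     (\<forall>i<k. g i \<in> C_space X \<and> (\<forall>x\<in>topspace X. 0 \<le> g i x)) \<and>
     (\<forall>x\<in>topspace X. (\<Sum>i<k. g i x) = 1)"

definition ext_ln :: "real \<Rightarrow> ereal" where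
  "ext_ln r = (if r = 0 then -\<infinity> else ereal (ln r))"

definition entropy_term :: "'a measure \<Rightarrow> ('a \<Rightarrow> real) \<Rightarrow> ('a \<Rightarrow> real) \<Rightarrow> ereal" where
  "entropy_term \<mu> g h =
     (if (LINT x|\<mu>. g x) = 0 then 0
      else ereal (LINT x|\<mu>. g x) * ext_ln ((LINT x|\<mu>. h x) / (LINT x|\<mu>. g x)))"

definition t_entropy ::
    "'a topology \<Rightarrow> (('a \<Rightarrow> real) \<Rightarrow> 'a \<Rightarrow> real) \<Rightarrow> 'a measure \<Rightarrow> ereal" where
  "t_entropy X A \<mu> =
     (INF n\<in>{1::nat..}. ereal (1 / real n) *
        (INF (k, g)\<in>{(k, g). partition_of_unity X k g}.
           \<Sum>i<k. entropy_term \<mu> (g i) ((A ^^ n) (g i))))"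

end

theory Submission
  imports Defs
begin

text \<open>
  Write \<open>B\<close> for the trace of \<open>A\<close> on \<open>Y\<close>. For nonnegative \<open>g\<close> one has \<open>B\<^sup>n g \<le> A\<^sup>n g\<close> on \<open>Y\<close>, so
  restricting partitions of unity from \<open>X\<close> to \<open>Y\<close> gives \<open>\<tau>\<^sub>Y(\<mu>) \<le> \<tau>(\<mu>)\<close>.

  Conversely, for every \<open>\<epsilon> > 0\<close> there is a continuous cutoff \<open>\<phi>\<close> with \<open>0 \<le> \<phi> \<le> 1\<close> and \<open>\<phi> = 1\<close> on \<open>Y\<close>
  such that \<open>A\<^sup>n(\<phi> g) \<le> B\<^sup>n g + \<epsilon>\<close> on \<open>Y\<close>. For \<open>n = 1\<close> this is regularity of the measures
  representing \<open>A\<close> followed by Dini's argument, which uses compatibility. The induction on \<open>n\<close>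
  replaces \<open>\<phi>\<close> by \<open>(\<psi> \<circ> \<alpha>) \<phi>\<close>, again a cutoff because \<open>\<alpha>(Y) \<subseteq> Y\<close>, and pulls \<open>\<psi>\<close> out of \<open>A\<close> by
  the transfer identity. A partition of unity \<open>h\<close> on \<open>Y\<close>, extended to \<open>X\<close>, is multiplied by \<open>\<phi>\<close>
  and completed by a function that vanishes on \<open>Y\<close> and so contributes nothing; then \<open>\<epsilon> \<rightarrow> 0\<close>.

  The second claim follows because the essential set is
  closed, forward invariant and, by inner regularity, of full measure for every invariant \<open>\<mu>\<close>.
\<close>

section \<open>Continuous functions on a compact Hausdorff space\<close>

lemma C_space_const [simp, intro]: "(\<lambda>x. c) \<in> C_space X"
  and C_space_add [intro!]: "f \<in> C_space X \<Longrightarrow> g \<in> C_space X \<Longrightarrow> (\<lambda>x. f x + g x) \<in> C_space X"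
  and C_space_diff [intro!]: "f \<in> C_space X \<Longrightarrow> g \<in> C_space X \<Longrightarrow> (\<lambda>x. f x - g x) \<in> C_space X"
  and C_space_mult [intro!]: "f \<in> C_space X \<Longrightarrow> g \<in> C_space X \<Longrightarrow> (\<lambda>x. f x * g x) \<in> C_space X"
  and C_space_max [intro!]: "f \<in> C_space X \<Longrightarrow> g \<in> C_space X \<Longrightarrow> (\<lambda>x. max (f x) (g x)) \<in> C_space X"
  and C_space_min [intro!]: "f \<in> C_space X \<Longrightarrow> g \<in> C_space X \<Longrightarrow> (\<lambda>x. min (f x) (g x)) \<in> C_space X"
  by (auto simp: C_space_def intro!: continuous_intros)

lemma C_space_sum [intro!]:
  "finite I \<Longrightarrow> (\<And>i. i \<in> I \<Longrightarrow> f i \<in> C_space X) \<Longrightarrow> (\<lambda>x. \<Sum>i\<in>I. f i x) \<in> C_space X"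
  by (induction I rule: finite_induct) auto

lemma C_space_subtopology: "f \<in> C_space X \<Longrightarrow> f \<in> C_space (subtopology X Y)"
  by (simp add: C_space_def continuous_map_from_subtopology)

lemma C_space_open_less: "f \<in> C_space X \<Longrightarrow> openin X {x \<in> topspace X. f x < c}"
  using openin_continuous_map_preimage[of X euclideanreal f "{..<c}"] by (simp add: C_space_def)

lemma C_space_open_greater: "f \<in> C_space X \<Longrightarrow> openin X {x \<in> topspace X. c < f x}"
  using openin_continuous_map_preimage[of X euclideanreal f "{c<..}"] by (simp add: C_space_def)

lemma C_space_closed_ge: "f \<in> C_space X \<Longrightarrow> closedin X {x \<in> topspace X. c \<le> f x}"
  using closedin_continuous_map_preimage[of X euclideanreal f "{c..}"] by (simp add: C_space_def)

lemma C_space_bounded: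
  assumes "compact_space X" "f \<in> C_space X"
  obtains B where "B > 0" "\<And>x. x \<in> topspace X \<Longrightarrow> \<bar>f x\<bar> \<le> B"
proof -
  have "compact (f ` topspace X)"
    using image_compactin[of X "topspace X" euclideanreal f] assms
    by (simp add: C_space_def compact_space_def)
  then obtain B where B: "\<And>y. y \<in> f ` topspace X \<Longrightarrow> norm y \<le> B"
    by (meson bounded_iff compact_imp_bounded)
  show thesis
    by (rule that[of "max B 1"]) (use B in \<open>force+\<close>)
qed

section \<open>The Borel sets of an abstract topology\<close>

lemma space_borel_of [simp]: "space (borel_of X) = topspace X"
  and sets_borel_of: "sets (borel_of X) = sigma_sets (topspace X) {U. openin X U}"
  using openin_subset[of X] by (auto simp: borel_of_def space_measure_of_conv sets_measure_of_conv)

lemma openin_borel_of: "openin X U \<Longrightarrow> U \<in> sets (borel_of X)"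
  by (auto simp: sets_borel_of)

lemma closedin_borel_of: "closedin X U \<Longrightarrow> U \<in> sets (borel_of X)"
  using sets.compl_sets[OF openin_borel_of[of X "topspace X - U"]]
  by (auto simp: closedin_def double_diff)

lemma continuous_map_borel_of:
  assumes "continuous_map X Y f"
  shows "f \<in> borel_of X \<rightarrow>\<^sub>M borel_of Y"
  using assms openin_subset[of Y] unfolding borel_of_def[of Y]
  by (intro measurable_measure_of)
     (auto simp: continuous_map_def openin_borel_of Int_def conj_commute vimage_def
      cong: conj_cong)

lemma C_space_measurable: "f \<in> C_space X \<Longrightarrow> f \<in> borel_measurable (borel_of X)"
  by (rule borel_measurableI)
     (use openin_continuous_map_preimage[of X euclideanreal f] in
       \<open>auto simp: C_space_def vimage_def Int_def conj_commute intro!: openin_borel_of\<close>)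

lemma C_space_Urysohn:
  assumes "compact_space X" "Hausdorff_space X" "closedin X S" "closedin X T" "S \<inter> T = {}"
  obtains f where "f \<in> C_space X" "\<And>x. x \<in> topspace X \<Longrightarrow> 0 \<le> f x \<and> f x \<le> 1"
    "\<And>x. x \<in> S \<Longrightarrow> f x = 0" "\<And>x. x \<in> T \<Longrightarrow> f x = (1::real)"
proof -
  have "normal_space X"
    using assms compact_Hausdorff_or_regular_imp_normal_space by blast
  then obtain f where f: "continuous_map X (top_of_set {0..1::real}) f" "f ` S \<subseteq> {0}" "f ` T \<subseteq> {1}"
    using Urysohn_lemma[of X S T 0 1] assms by (auto simp: disjnt_def)
  show thesis
    by (rule that[of f]) (use f in \<open>auto simp: C_space_def continuous_map_in_subtopology\<close>)
qed

section \<open>The Riesz representation theorem\<close>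

text \<open>This will be instantiated with the functional sending \<open>f\<close> to
  \<open>A f x\<close> at a fixed point \<open>x\<close>; identities of functions are again only
  demanded through their values on \<open>topspace X\<close>.\<close>

locale positive_functional =
  fixes X :: "'a topology" and L :: "('a \<Rightarrow> real) \<Rightarrow> real"
  assumes compact: "compact_space X" and Hausdorff: "Hausdorff_space X"
    and add: "\<And>f g. f \<in> C_space X \<Longrightarrow> g \<in> C_space X \<Longrightarrow> L (\<lambda>x. f x + g x) = L f + L g"
    and scale: "\<And>c f. f \<in> C_space X \<Longrightarrow> L (\<lambda>x. c * f x) = c * L f"
    and nonneg: "\<And>f. f \<in> C_space X \<Longrightarrow> (\<And>x. x \<in> topspace X \<Longrightarrow> 0 \<le> f x) \<Longrightarrow> 0 \<le> L f"
begin

lemma diff: "f \<in> C_space X \<Longrightarrow> g \<in> C_space X \<Longrightarrow> L (\<lambda>x. f x - g x) = L f - L g"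
  using add[of "\<lambda>x. f x - g x" g] by (simp add: C_space_diff)

lemma mono:
  assumes "f \<in> C_space X" "g \<in> C_space X" "\<And>x. x \<in> topspace X \<Longrightarrow> f x \<le> g x"
  shows "L f \<le> L g"
  using nonneg[of "\<lambda>x. g x - f x"] diff[of g f] assms by auto

lemma const: "L (\<lambda>x. c) = c * L (\<lambda>x. 1)"
  using scale[of "\<lambda>x. 1" c] by simp

lemma L1_nonneg: "0 \<le> L (\<lambda>x. 1)"
  by (rule nonneg) auto

lemma L_sum:
  "finite I \<Longrightarrow> (\<And>i. i \<in> I \<Longrightarrow> f i \<in> C_space X) \<Longrightarrow> L (\<lambda>x. \<Sum>i\<in>I. f i x) = (\<Sum>i\<in>I. L (f i))"
proof (induction I rule: finite_induct)
  case empty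
  show ?case using const[of 0] by simp
next
  case (insert i I)
  have "L (\<lambda>x. f i x + (\<Sum>i\<in>I. f i x)) = L (f i) + L (\<lambda>x. \<Sum>i\<in>I. f i x)"
    by (rule add) (use insert in auto)
  with insert show ?case by simp
qed

section \<open>The content of open sets\<close>

definition below :: "'a set \<Rightarrow> ('a \<Rightarrow> real) set" where
  "below U = {f \<in> C_space X. (\<forall>x\<in>topspace X. 0 \<le> f x \<and> f x \<le> 1) \<and> (\<forall>x\<in>topspace X - U. f x = 0)}"

lemma below_C: "f \<in> below U \<Longrightarrow> f \<in> C_space X"
  by (simp add: below_def)

lemma below_nonneg: "f \<in> below U \<Longrightarrow> 0 \<le> L f"
  by (intro nonneg) (auto simp: below_def)

lemma below_zero: "(\<lambda>x. 0) \<in> below U"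
  by (simp add: below_def)

text \<open>Members of \<open>below U\<close> vanish off \<open>U\<close> but need not have compact
  support in \<open>U\<close>. For \<open>e > 0\<close> the cut function vanishes off the compact
  set where \<open>f \<ge> e\<close>, which lies in \<open>U\<close>, while \<open>f\<close> exceeds
  it by at most \<open>e\<close>.\<close>

lemma below_cut:
  assumes "f \<in> below U" "0 \<le> e"
  shows "(\<lambda>x. max (f x - e) 0) \<in> below U" "L f \<le> L (\<lambda>x. max (f x - e) 0) + e * L (\<lambda>x. 1)"
proof -
  have C: "f \<in> C_space X" using assms by (simp add: below_def)
  show "(\<lambda>x. max (f x - e) 0) \<in> below U"
    using assms by (force simp: below_def)
  have "L f \<le> L (\<lambda>x. max (f x - e) 0 + e)"
    using C by (intro mono) auto
  also have "\<dots> = L (\<lambda>x. max (f x - e) 0) + e * L (\<lambda>x. 1)"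
    using C by (subst add) (auto simp: const[of e])
  finally show "L f \<le> L (\<lambda>x. max (f x - e) 0) + e * L (\<lambda>x. 1)" .
qed

definition cap :: "'a set \<Rightarrow> ennreal" where
  "cap U = (SUP f\<in>below U. ennreal (L f))"

lemma cap_upper: "f \<in> below U \<Longrightarrow> ennreal (L f) \<le> cap U"
  unfolding cap_def by (rule SUP_upper)

lemma cap_mono: "U \<subseteq> V \<Longrightarrow> cap U \<le> cap V"
  unfolding cap_def by (rule SUP_subset_mono) (auto simp: below_def)

lemma cap_le_L1: "cap U \<le> ennreal (L (\<lambda>x. 1))"
  unfolding cap_def by (rule SUP_least) (auto intro!: ennreal_leI mono simp: below_def)

lemma cap_finite: "cap U < top"
  using cap_le_L1 ennreal_less_top le_less_trans by blast

lemma cap_approx: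
  assumes "0 < e"
  obtains f where "f \<in> below U" "cap U \<le> ennreal (L f) + ennreal e"
proof -
  have "\<exists>f\<in>below U. cap U < ennreal (L f) + ennreal e"
    using cap_finite[of U] below_zero[of U] by (intro SUP_approx_ennreal[OF assms _ cap_def]) auto
  then show thesis using that less_imp_le by blast
qed

text \<open>The loss from cutting at height \<open>e\<close> is at most
  \<open>e * L (\<lambda>x. 1)\<close>, which tends to 0 with \<open>e\<close>. Upper bounds for
  \<open>cap\<close> may thus be checked on functions supported in a compact subset of
  \<open>U\<close>.\<close>

lemma cap_leI:
  assumes "\<And>f e. f \<in> below U \<Longrightarrow> 0 < e \<Longrightarrow> ennreal (L (\<lambda>x. max (f x - e) 0)) \<le> B"
  shows "cap U \<le> B"
  unfolding cap_def
proof (rule SUP_least)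
  fix f assume f: "f \<in> below U"
  show "ennreal (L f) \<le> B"
  proof (rule ennreal_le_epsilon)
    fix d :: real assume d: "0 < d"
    \<comment> \<open>The added 1 keeps the denominator positive when
      \<open>L (\<lambda>x. 1) = 0\<close>.\<close>
    define e where "e = d / (L (\<lambda>x. 1) + 1)"
    have e: "0 < e" "e * L (\<lambda>x. 1) \<le> d"
      using d L1_nonneg by (auto simp: e_def field_simps)
    have "L f \<le> L (\<lambda>x. max (f x - e) 0) + d"
      using below_cut(2)[OF f, of e] e by auto
    then have "ennreal (L f) \<le> ennreal (L (\<lambda>x. max (f x - e) 0)) + ennreal d"
      using below_nonneg[OF below_cut(1)[OF f, of e]] e d
      by (simp add: ennreal_leI flip: ennreal_plus)
    also have "\<dots> \<le> B + ennreal d"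
      using assms[OF f e(1)] by (rule add_right_mono)
    finally show "ennreal (L f) \<le> B + ennreal d" .
  qed
qed

text \<open>The closed sets \<open>K - U\<close> and \<open>K - V\<close> are disjoint, so a Urysohn
  function \<open>h\<close> splits the cut function \<open>f'\<close> into \<open>h * f'\<close>,
  which lives in \<open>U\<close>, and \<open>(1 - h) * f'\<close>, which lives in
  \<open>V\<close>.\<close>

lemma cap_Un:
  assumes U: "openin X U" and V: "openin X V"
  shows "cap (U \<union> V) \<le> cap U + cap V"
proof (rule cap_leI)
  fix f and e :: real assume f: "f \<in> below (U \<union> V)" and e: "0 < e"
  define K where "K = {x \<in> topspace X. e \<le> f x}"
  define f' where "f' x = max (f x - e) 0" for x
  have f': "f' \<in> below (U \<union> V)"
    unfolding f'_def using below_cut(1)[OF f] e by auto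
  have K: "closedin X K"
    unfolding K_def using f by (auto intro: C_space_closed_ge below_C)
  have "K \<subseteq> U \<union> V"
    using f e by (force simp: K_def below_def)
  then obtain h where h: "h \<in> C_space X" "\<And>x. x \<in> topspace X \<Longrightarrow> 0 \<le> h x \<and> h x \<le> 1"
     "\<And>x. x \<in> K - U \<Longrightarrow> h x = 0" "\<And>x. x \<in> K - V \<Longrightarrow> h x = 1"
    using C_space_Urysohn[OF compact Hausdorff, of "K - U" "K - V"] closedin_diff[OF K U]
      closedin_diff[OF K V] by blast
  have zero: "f' x = 0" if "x \<in> topspace X" "x \<notin> K" for x
    using that by (auto simp: f'_def K_def)
  have 1: "(\<lambda>x. h x * f' x) \<in> below U"
    using h f' zero by (auto simp: below_def mult_le_one)
  have 2: "(\<lambda>x. (1 - h x) * f' x) \<in> below V"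
    using h f' zero by (fastforce simp: below_def mult_le_one)
  have "L f' = L (\<lambda>x. h x * f' x + (1 - h x) * f' x)"
    by (simp add: algebra_simps)
  also have "\<dots> = L (\<lambda>x. h x * f' x) + L (\<lambda>x. (1 - h x) * f' x)"
    using 1 2 by (intro add below_C)
  finally have "ennreal (L f') = ennreal (L (\<lambda>x. h x * f' x)) + ennreal (L (\<lambda>x. (1 - h x) * f' x))"
    using below_nonneg[OF 1] below_nonneg[OF 2] by simp
  also have "\<dots> \<le> cap U + cap V"
    using 1 2 by (intro add_mono cap_upper)
  finally show "ennreal (L (\<lambda>x. max (f x - e) 0)) \<le> cap U + cap V"
    by (simp add: f'_def[abs_def])
qed

lemma cap_empty: "cap {} = 0"
proof -
  have "cap {} \<le> 0"
    unfolding cap_def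
  proof (rule SUP_least)
    fix f assume "f \<in> below {}"
    then have "L f \<le> L (\<lambda>x. 0)" by (intro mono) (auto simp: below_def)
    then show "ennreal (L f) \<le> 0" using const[of 0] by (simp add: ennreal_neg)
  qed
  then show ?thesis by simp
qed

lemma cap_UN_finite:
  assumes "\<And>i::nat. openin X (U i)"
  shows "cap (\<Union>i<n. U i) \<le> (\<Sum>i<n. cap (U i))"
proof (induction n)
  case (Suc n)
  have "cap (\<Union>i<Suc n. U i) \<le> cap (\<Union>i<n. U i) + cap (U n)"
    using cap_Un[of "\<Union>i<n. U i" "U n"] assms by (auto simp: lessThan_Suc Un_commute)
  also have "\<dots> \<le> (\<Sum>i<n. cap (U i)) + cap (U n)"
    using Suc by (rule add_right_mono)
  finally show ?case by simp
qed (simp add: cap_empty)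

text \<open>A cut function lives on a compact set, which finitely many of the \<open>U i\<close>
  cover; finite subadditivity does the rest.\<close>

lemma cap_UN:
  assumes U: "\<And>i::nat. openin X (U i)"
  shows "cap (\<Union>i. U i) \<le> (\<Sum>i. cap (U i))"
proof (rule cap_leI)
  fix f and e :: real assume f: "f \<in> below (\<Union>i. U i)" and e: "0 < e"
  define K where "K = {x \<in> topspace X. e \<le> f x}"
  have "compactin X K"
    unfolding K_def using f compact
    by (auto intro: C_space_closed_ge below_C closedin_compact_space)
  moreover have "K \<subseteq> (\<Union>i. U i)"
    using f e by (force simp: K_def below_def)
  ultimately obtain F where F: "finite F" "F \<subseteq> range U" "K \<subseteq> \<Union>F"
    using compactinD[of X K "range U"] U by auto
  then obtain I where I: "finite I" "F = U ` I"
    by (meson finite_subset_image)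
  \<comment> \<open>For empty \<open>I\<close> the value of \<open>Max I\<close> is unspecified, but
    then the inclusion below is trivial.\<close>
  define n where "n = Suc (Max I)"
  have "I \<subseteq> {..<n}"
    using I by (auto simp: n_def less_Suc_eq_le)
  then have K: "K \<subseteq> (\<Union>i<n. U i)"
    using F(3) unfolding I(2) by blast
  have "(\<lambda>x. max (f x - e) 0) \<in> below (\<Union>i<n. U i)"
    using below_cut(1)[OF f, of e] e K by (auto simp: below_def K_def)
  then have "ennreal (L (\<lambda>x. max (f x - e) 0)) \<le> cap (\<Union>i<n. U i)"
    by (rule cap_upper)
  also have "\<dots> \<le> (\<Sum>i<n. cap (U i))"
    by (rule cap_UN_finite[OF U])
  also have "\<dots> \<le> (\<Sum>i. cap (U i))"
    by (rule sum_le_suminf) auto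
  finally show "ennreal (L (\<lambda>x. max (f x - e) 0)) \<le> (\<Sum>i. cap (U i))" .
qed

section \<open>The outer measure and the measurability of open sets\<close>

definition outer :: "'a set \<Rightarrow> ennreal" where
  "outer E = (INF U\<in>{U. openin X U \<and> E \<subseteq> U}. cap U)"

lemma outer_le: "openin X U \<Longrightarrow> E \<subseteq> U \<Longrightarrow> outer E \<le> cap U"
  unfolding outer_def by (rule INF_lower) auto

lemma outer_open: "openin X U \<Longrightarrow> outer U = cap U"
  by (intro antisym outer_le) (auto simp: outer_def intro!: INF_greatest cap_mono)

lemma outer_mono: "E \<subseteq> F \<Longrightarrow> outer E \<le> outer F"
  unfolding outer_def by (rule INF_superset_mono) auto

lemma outer_finite: "E \<subseteq> topspace X \<Longrightarrow> outer E < top"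
  using outer_le[of "topspace X" E] cap_finite[of "topspace X"] by (auto intro: le_less_trans)

lemma outer_approx:
  assumes "0 < e" "E \<subseteq> topspace X"
  obtains U where "openin X U" "E \<subseteq> U" "cap U \<le> outer E + ennreal e"
proof -
  have "\<exists>U\<in>{U. openin X U \<and> E \<subseteq> U}. cap U < outer E + ennreal e"
    using outer_finite[OF assms(2)] by (intro INF_approx_ennreal[OF assms(1) outer_def]) auto
  then show thesis using that less_imp_le by blast
qed

text \<open>For countable subadditivity each \<open>E i\<close> is enclosed in an open set with
  excess at most \<open>e * (1/2)^Suc i\<close>. These errors add up to \<open>e\<close>, and
  \<open>cap_UN\<close> applies to the open sets.\<close>

lemma outer_measure_space_outer: "outer_measure_space (Pow (topspace X)) outer"
  unfolding outer_measure_space_def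
proof (intro conjI)
  show "positive (Pow (topspace X)) outer"
    by (simp add: positive_def outer_open cap_empty)
  show "increasing (Pow (topspace X)) outer"
    by (simp add: increasing_def outer_mono)
  show "countably_subadditive (Pow (topspace X)) outer"
    unfolding countably_subadditive_def
  proof (intro allI impI)
    fix E :: "nat \<Rightarrow> 'a set"
    assume E: "range E \<subseteq> Pow (topspace X)"
    show "outer (\<Union>i. E i) \<le> (\<Sum>i. outer (E i))"
    proof (rule ennreal_le_epsilon)
      fix e :: real assume e: "0 < e"
      have "\<exists>U. openin X U \<and> E i \<subseteq> U \<and> cap U \<le> outer (E i) + ennreal (e * (1/2)^Suc i)" for i
        using outer_approx[of "e * (1/2)^Suc i" "E i"] E e
        by (metis UNIV_I image_subset_iff mult_pos_pos half_gt_zero_iff Pow_iff zero_less_one zero_less_power)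
      then obtain U where U: "\<And>i. openin X (U i)" "\<And>i. E i \<subseteq> U i"
        "\<And>i. cap (U i) \<le> outer (E i) + ennreal (e * (1/2)^Suc i)"
        by metis
      have "outer (\<Union>i. E i) \<le> cap (\<Union>i. U i)"
        using U by (intro outer_le) auto
      also have "\<dots> \<le> (\<Sum>i. cap (U i))"
        using U by (intro cap_UN)
      also have "\<dots> \<le> (\<Sum>i. outer (E i) + ennreal (e * (1/2)^Suc i))"
        by (intro suminf_le U) auto
      also have "\<dots> = (\<Sum>i. outer (E i)) + (\<Sum>i. ennreal (e * (1/2)^Suc i))"
        by (rule suminf_add[symmetric]) auto
      also have "(\<Sum>i. ennreal (e * (1/2)^Suc i)) = ennreal e"
        using sums_mult[OF power_half_series, of e] e
        by (intro suminf_ennreal_eq) auto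
      finally show "outer (\<Union>i. E i) \<le> (\<Sum>i. outer (E i)) + ennreal e" .
    qed
  qed
qed

text \<open>This is Caratheodory's inequality for an open test set \<open>V\<close>. Let
  \<open>f\<close> nearly attain \<open>cap (V \<inter> U)\<close>. The part \<open>W\<close> of
  \<open>V\<close> where \<open>f < d\<close> is open and contains \<open>V - U\<close>; let
  \<open>g\<close> nearly attain \<open>cap W\<close>. The cut of \<open>f\<close> at
  \<open>d\<close> and \<open>g\<close> are nowhere both nonzero, so their sum is at most 1 and
  belongs to \<open>below V\<close>.\<close>

lemma open_split:
  assumes U: "openin X U" and V: "openin X V"
  shows "cap (V \<inter> U) + outer (V - U) \<le> cap V"
proof (rule ennreal_le_epsilon)
  fix e :: real assume e: "0 < e"
  \<comment> \<open>Cutting \<open>f\<close> costs \<open>d * L (\<lambda>x. 1)\<close> and the two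
    approximations cost \<open>d\<close> each, in total exactly \<open>e\<close>.\<close>
  define d where "d = e / (L (\<lambda>x. 1) + 2)"
  have d: "0 < d" "d * L (\<lambda>x. 1) + 2 * d = e"
    using e L1_nonneg by (auto simp: d_def divide_simps) (simp add: algebra_simps)
  obtain f where f: "f \<in> below (V \<inter> U)" "cap (V \<inter> U) \<le> ennreal (L f) + ennreal d"
    using cap_approx d by blast
  define W where "W = V \<inter> {x \<in> topspace X. f x < d}"
  have W: "openin X W"
    unfolding W_def using f V by (intro openin_Int C_space_open_less) (auto simp: below_def)
  obtain g where g: "g \<in> below W" "cap W \<le> ennreal (L g) + ennreal d"
    using cap_approx d by blast
  have f': "(\<lambda>x. max (f x - d) 0) \<in> below (V \<inter> U)"
    using below_cut(1)[OF f(1)] d by auto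
  have fg: "(\<lambda>x. max (f x - d) 0 + g x) \<in> below V"
    unfolding below_def
  proof (intro CollectI conjI ballI)
    show "(\<lambda>x. max (f x - d) 0 + g x) \<in> C_space X"
      using f' g by (auto simp: below_def)
    fix x assume x: "x \<in> topspace X"
    show "0 \<le> max (f x - d) 0 + g x" "max (f x - d) 0 + g x \<le> 1"
      using x f(1) g(1) d by (cases "f x < d"; force simp: below_def W_def)+
  next
    fix x assume x: "x \<in> topspace X - V"
    then show "max (f x - d) 0 + g x = 0"
      using f(1) g(1) d by (force simp: below_def W_def)
  qed
  have Vs: "V - U \<subseteq> W"
    using f(1) d openin_subset[OF V] by (force simp: below_def W_def)
  have "cap (V \<inter> U) + outer (V - U) \<le> (ennreal (L f) + ennreal d) + (ennreal (L g) + ennreal d)"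
    using f g outer_le[OF W Vs] by (intro add_mono) auto
  also have "\<dots> = ennreal (L f + L g + 2 * d)"
    using below_nonneg[OF f(1)] below_nonneg[OF g(1)] d by (simp flip: ennreal_plus)
  also have "\<dots> \<le> ennreal (L (\<lambda>x. max (f x - d) 0 + g x) + e)"
    using below_cut(2)[OF f(1), of d] d below_C[OF f'] below_C[OF g(1)]
    by (intro ennreal_leI) (simp add: add)
  also have "\<dots> = ennreal (L (\<lambda>x. max (f x - d) 0 + g x)) + ennreal e"
    using below_nonneg[OF fg] e by simp
  also have "\<dots> \<le> cap V + ennreal e"
    by (intro add_right_mono cap_upper fg)
  finally show "cap (V \<inter> U) + outer (V - U) \<le> cap V + ennreal e" .
qed

text \<open>An arbitrary test set \<open>E\<close> is reduced to the open sets \<open>V\<close>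
  containing it, since \<open>outer E\<close> is an infimum over those; the opposite inequality is
  subadditivity.\<close>

lemma open_lambda_system:
  assumes U: "openin X U"
  shows "U \<in> lambda_system (topspace X) (Pow (topspace X)) outer"
proof -
  interpret P: sigma_algebra "topspace X" "Pow (topspace X)"
    by (rule sigma_algebra_Pow)
  have "outer (U \<inter> E) + outer (E - U) = outer E" if E: "E \<subseteq> topspace X" for E
  proof (rule antisym)
    show "outer (U \<inter> E) + outer (E - U) \<le> outer E"
      unfolding outer_def[of E]
    proof (rule INF_greatest)
      fix V assume V: "V \<in> {U. openin X U \<and> E \<subseteq> U}"
      have "outer (U \<inter> E) + outer (E - U) \<le> outer (V \<inter> U) + outer (V - U)"
        using V by (intro add_mono outer_mono) auto
      also have "\<dots> \<le> cap V"
        using V U open_split[OF U, of V] by (simp add: outer_open openin_Int)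
      finally show "outer (U \<inter> E) + outer (E - U) \<le> cap V" .
    qed
    have "subadditive (Pow (topspace X)) outer"
      using outer_measure_space_outer P.countably_subadditive_subadditive
      by (auto simp: outer_measure_space_def)
    then have "outer ((U \<inter> E) \<union> (E - U)) \<le> outer (U \<inter> E) + outer (E - U)"
      using E by (intro subadditiveD) auto
    moreover have "(U \<inter> E) \<union> (E - U) = E" by auto
    ultimately show "outer E \<le> outer (U \<inter> E) + outer (E - U)" by simp
  qed
  then show ?thesis
    using openin_subset[OF U] by (simp add: P.lambda_system_eq Int_commute)
qed

section \<open>The Riesz measure and its regularity\<close>

definition riesz :: "'a measure" where
  "riesz = measure_of (topspace X) {U. openin X U} outer"

lemma space_riesz [simp]: "space riesz = topspace X"
  and sets_riesz [simp, measurable_cong]: "sets riesz = sets (borel_of X)"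
  using openin_subset[of X]
  by (auto simp: riesz_def sets_borel_of space_measure_of_conv sets_measure_of_conv)

text \<open>By Caratheodory the measurable sets form a sigma-algebra on which \<open>outer\<close>
  is a measure. It contains the open sets, hence the Borel sets.\<close>

lemma emeasure_riesz:
  assumes "B \<in> sets (borel_of X)"
  shows "emeasure riesz B = outer B"
proof -
  interpret P: sigma_algebra "topspace X" "Pow (topspace X)"
    by (rule sigma_algebra_Pow)
  let ?S = "lambda_system (topspace X) (Pow (topspace X)) outer"
  have ms: "measure_space (topspace X) ?S outer"
    by (rule P.caratheodory_lemma[OF outer_measure_space_outer])
  then have sa: "sigma_algebra (topspace X) ?S" by (simp add: measure_space_def)
  have "sigma_sets (topspace X) {U. openin X U} \<subseteq> ?S"
    using open_lambda_system by (intro sigma_algebra.sigma_sets_subset[OF sa]) auto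
  moreover have "sigma_algebra (topspace X) (sigma_sets (topspace X) {U. openin X U})"
    using openin_subset[of X] by (intro sigma_algebra_sigma_sets) auto
  ultimately have "measure_space (topspace X) (sigma_sets (topspace X) {U. openin X U}) outer"
    using ms by (blast intro: measure_down)
  then show ?thesis
    using assms openin_subset[of X]
    by (simp add: riesz_def emeasure_measure_of_conv sets_borel_of)
qed

lemma finite_measure_riesz: "finite_measure riesz"
  using outer_finite[of "topspace X"]
  by (intro finite_measureI) (simp add: emeasure_riesz openin_borel_of less_top)

lemma emeasure_riesz_open: "openin X U \<Longrightarrow> emeasure riesz U = cap U"
  by (simp add: emeasure_riesz openin_borel_of outer_open)

lemma cap_topspace: "cap (topspace X) = ennreal (L (\<lambda>x. 1))"
  by (intro antisym cap_le_L1 cap_upper) (simp add: below_def)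

text \<open>Outer regularity is built into \<open>outer\<close>. For inner regularity the complement
  of \<open>B\<close> is enclosed in an open \<open>U\<close> with excess at most \<open>e\<close>;
  the complement \<open>K\<close> of \<open>U\<close> is closed, hence compact, and
  \<open>B - K\<close> is exactly that excess.\<close>

lemma regular_riesz: "regular_borel_measure X riesz"
  unfolding regular_borel_measure_def
proof (intro conjI ballI)
  interpret finite_measure riesz by (rule finite_measure_riesz)
  show "finite_measure riesz" by (rule finite_measure_riesz)
  fix B assume "B \<in> sets riesz"
  then have B: "B \<in> sets (borel_of X)" and Bs: "B \<subseteq> topspace X"
    using sets.sets_into_space by fastforce+
  show outer_reg: "emeasure riesz B = (INF U\<in>{U. openin X U \<and> B \<subseteq> U}. emeasure riesz U)"
    unfolding emeasure_riesz[OF B] outer_def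
    by (rule INF_cong) (auto simp: emeasure_riesz_open)
  show "emeasure riesz B = (SUP K\<in>{K. compactin X K \<and> K \<subseteq> B}. emeasure riesz K)"
  proof (rule antisym)
    show "(SUP K\<in>{K. compactin X K \<and> K \<subseteq> B}. emeasure riesz K) \<le> emeasure riesz B"
      using B by (auto intro!: SUP_least emeasure_mono)
    show "emeasure riesz B \<le> (SUP K\<in>{K. compactin X K \<and> K \<subseteq> B}. emeasure riesz K)"
    proof (rule ennreal_le_epsilon)
      fix e :: real assume e: "0 < e"
      obtain U where U: "openin X U" "topspace X - B \<subseteq> U" "cap U \<le> outer (topspace X - B) + ennreal e"
        using outer_approx[OF e, of "topspace X - B"] by auto
      define K where "K = topspace X - U"
      have K: "closedin X K" "K \<subseteq> B"
        using U openin_subset[of X U] by (auto simp: K_def)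
      have "U - (topspace X - B) = B - K"
        using U Bs openin_subset[of X U] by (auto simp: K_def)
      moreover have "emeasure riesz U = emeasure riesz (topspace X - B) + emeasure riesz (U - (topspace X - B))"
        using U B sets.compl_sets[OF B]
        by (subst plus_emeasure) (auto simp: openin_borel_of intro!: arg_cong[where f="emeasure riesz"])
      ultimately have "emeasure riesz (topspace X - B) + emeasure riesz (B - K)
          \<le> emeasure riesz (topspace X - B) + ennreal e"
        using U(3) sets.compl_sets[OF B] by (simp add: emeasure_riesz_open U(1) emeasure_riesz)
      then have "emeasure riesz (B - K) \<le> ennreal e"
        using emeasure_finite[of "topspace X - B"]
        by (simp add: ennreal_add_left_cancel_le)
      moreover have "emeasure riesz B = emeasure riesz K + emeasure riesz (B - K)"
        using K B by (subst plus_emeasure) (auto simp: closedin_borel_of intro!: arg_cong[where f="emeasure riesz"])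
      moreover have "emeasure riesz K \<le> (SUP K\<in>{K. compactin X K \<and> K \<subseteq> B}. emeasure riesz K)"
        using K compact by (intro SUP_upper) (auto intro: closedin_compact_space)
      ultimately show "emeasure riesz B \<le> (SUP K\<in>{K. compactin X K \<and> K \<subseteq> B}. emeasure riesz K) + ennreal e"
        by (simp add: add_mono)
    qed
  qed
qed simp

end

section \<open>Integration of continuous functions against the Riesz measure\<close>

lemma C_space_integrable:
  assumes "compact_space X" "finite_measure \<nu>" "sets \<nu> = sets (borel_of X)" "f \<in> C_space X"
  shows "integrable \<nu> f"
proof -
  interpret finite_measure \<nu> by fact
  obtain B where "\<And>x. x \<in> topspace X \<Longrightarrow> \<bar>f x\<bar> \<le> B"
    using C_space_bounded assms(1,4) by metis
  moreover have "f \<in> borel_measurable \<nu>"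
    using C_space_measurable[OF assms(4)] by (simp add: measurable_cong_sets[OF assms(3) refl])
  ultimately show ?thesis
    using sets_eq_imp_space_eq[OF assms(3)]
    by (intro integrable_const_bound[where B=B]) auto
qed

text \<open>This serves the layer cake argument with \<open>t = n * f x\<close>: the summands are
  the slices of unit height, and truncation at \<open>n\<close> has no effect when
  \<open>f x \<le> 1\<close>.\<close>

lemma sum_clip:
  fixes t :: real
  assumes "0 \<le> t"
  shows "(\<Sum>k<n. min (max (t - real k) 0) 1) = min t (real n)"
  using assms by (induction n) (auto simp: min_def max_def)

context positive_functional
begin

lemma below_le_measure:
  assumes "openin X U" "f \<in> below U"
  shows "L f \<le> measure riesz U"
proof -
  interpret finite_measure riesz by (rule finite_measure_riesz)
  have "ennreal (L f) \<le> ennreal (measure riesz U)"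
    using cap_upper[OF assms(2)] assms(1) by (simp add: emeasure_eq_measure flip: emeasure_riesz_open)
  then show ?thesis by simp
qed

lemma riesz_integrable: "f \<in> C_space X \<Longrightarrow> integrable riesz f"
  by (rule C_space_integrable[OF compact finite_measure_riesz]) auto

lemma measure_le_integral:
  assumes "openin X U" "f \<in> C_space X" "\<And>x. x \<in> topspace X \<Longrightarrow> 0 \<le> f x" "\<And>x. x \<in> U \<Longrightarrow> 1 \<le> f x"
  shows "measure riesz U \<le> (LINT x|riesz. f x)"
proof -
  interpret finite_measure riesz by (rule finite_measure_riesz)
  have U: "U \<in> sets riesz" using assms(1) by (simp add: openin_borel_of)
  have "(LINT x|riesz. indicator U x) \<le> (LINT x|riesz. f x)"
    using U assms by (intro integral_mono riesz_integrable[OF assms(2)] integrable_real_indicator)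
      (auto simp: less_top[symmetric] indicator_def)
  moreover have "U \<inter> topspace X = U" using openin_subset[OF assms(1)] by auto
  ultimately show ?thesis by simp
qed

text \<open>Layer cake: cutting \<open>f\<close> into slices of height \<open>1 / n\<close> sandwiches both \<open>L f\<close> and the
  integral between Riemann sums of the distribution function of \<open>f\<close>.\<close>

lemma L_le_integral_approx:
  assumes f: "f \<in> C_space X" and bd: "\<And>x. x \<in> topspace X \<Longrightarrow> 0 \<le> f x \<and> f x \<le> 1" and n: "0 < n"
  shows "L f \<le> (LINT x|riesz. f x) + measure riesz (topspace X) / real n"
proof -
  interpret finite_measure riesz by (rule finite_measure_riesz)
  define U where "U k = {x \<in> topspace X. real k < real n * f x}" for k
  define s where "s k x = min (max (real n * f x - real k) 0) 1" for k x
  have nf: "(\<lambda>x. real n * f x) \<in> C_space X" using f by auto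
  have U: "openin X (U k)" for k
    unfolding U_def using nf by (rule C_space_open_greater)
  have s: "s k \<in> C_space X" for k
    unfolding s_def using nf by auto
  have sum: "(\<Sum>k<n. s k x) = real n * f x" if "x \<in> topspace X" for x
    using sum_clip[of "real n * f x" n] bd[OF that] n by (simp add: s_def min_absorb1 mult_left_le)
  have "real n * L f = L (\<lambda>x. \<Sum>k<n. s k x)"
    unfolding scale[OF f, symmetric]
    using s nf sum by (intro antisym mono) auto
  also have "\<dots> = (\<Sum>k<n. L (s k))"
    using s by (intro L_sum) auto
  \<comment> \<open>The slice \<open>s k\<close> vanishes off \<open>U k\<close>, which bounds
    \<open>L (s k)\<close> from above, and equals 1 on \<open>U (Suc k)\<close>, which bounds its
    integral from below. Shifting the index costs one term, at most the total mass; division by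
    \<open>n\<close> turns it into the stated error.\<close>
  also have "\<dots> \<le> (\<Sum>k<n. measure riesz (U k))"
    using U s by (intro sum_mono below_le_measure) (auto simp: below_def s_def U_def)
  also have "\<dots> \<le> measure riesz (U 0) + (\<Sum>k<n. measure riesz (U (Suc k)))"
    unfolding sum.lessThan_Suc_shift[of "\<lambda>k. measure riesz (U k)" n, symmetric]
    by simp
  also have "\<dots> \<le> measure riesz (topspace X) + (\<Sum>k<n. LINT x|riesz. s k x)"
  proof (intro add_mono sum_mono)
    show "measure riesz (U 0) \<le> measure riesz (topspace X)"
      using openin_subset[OF U] by (intro finite_measure_mono) (auto simp: openin_borel_of)
    show "measure riesz (U (Suc k)) \<le> (LINT x|riesz. s k x)" for k
      by (rule measure_le_integral[OF U s]) (auto simp: s_def U_def)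
  qed
  also have "(\<Sum>k<n. LINT x|riesz. s k x) = (LINT x|riesz. (\<Sum>k<n. s k x))"
    by (rule Bochner_Integration.integral_sum[symmetric]) (rule riesz_integrable[OF s])
  also have "\<dots> = (LINT x|riesz. real n * f x)"
    by (rule Bochner_Integration.integral_cong) (auto simp: sum)
  finally show ?thesis using n by (simp add: field_simps)
qed

lemma L_le_integral:
  assumes f: "f \<in> C_space X" and bd: "\<And>x. x \<in> topspace X \<Longrightarrow> 0 \<le> f x \<and> f x \<le> 1"
  shows "L f \<le> (LINT x|riesz. f x)"
proof -
  have "(\<lambda>n. (LINT x|riesz. f x) + measure riesz (topspace X) / real n) \<longlonglongrightarrow> (LINT x|riesz. f x) + 0"
    by (intro tendsto_intros lim_const_over_n)
  moreover have "\<forall>\<^sub>F n in sequentially. L f \<le> (LINT x|riesz. f x) + measure riesz (topspace X) / real n"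
    using eventually_gt_at_top[of 0] by eventually_elim (rule L_le_integral_approx[OF f bd])
  ultimately have "L f \<le> (LINT x|riesz. f x) + 0"
    by (rule tendsto_lowerbound) simp
  then show ?thesis by simp
qed

lemma measure_riesz_topspace: "measure riesz (topspace X) = L (\<lambda>x. 1)"
  using L1_nonneg by (simp add: measure_def emeasure_riesz_open cap_topspace)

text \<open>For \<open>0 \<le> h \<le> 1\<close> the inequality \<open>L_le_integral\<close> applied
  to \<open>1 - h\<close> gives the reverse one, because both functionals agree on constants. A
  general \<open>f\<close> is carried into the unit interval by an affine rescaling.\<close>

lemma integral_riesz:
  assumes f: "f \<in> C_space X"
  shows "(LINT x|riesz. f x) = L f"
proof -
  interpret finite_measure riesz by (rule finite_measure_riesz)
  have unit: "(LINT x|riesz. h x) = L h"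
    if h: "h \<in> C_space X" "\<And>x. x \<in> topspace X \<Longrightarrow> 0 \<le> h x \<and> h x \<le> 1" for h
  proof (rule antisym)
    have "L (\<lambda>x. 1 - h x) \<le> (LINT x|riesz. 1 - h x)"
      using h by (intro L_le_integral) auto
    then show "(LINT x|riesz. h x) \<le> L h"
      using h riesz_integrable[OF h(1)] diff[of "\<lambda>x. 1" h] by (simp add: measure_riesz_topspace)
  qed (rule L_le_integral[OF h])
  obtain B where B: "B > 0" "\<And>x. x \<in> topspace X \<Longrightarrow> \<bar>f x\<bar> \<le> B"
    using C_space_bounded[OF compact f] by metis
  define h where "h x = (1 / (2 * B)) * (f x + B)" for x
  have h: "h \<in> C_space X" unfolding h_def using f by (intro C_space_mult C_space_add C_space_const)
  have "0 \<le> h x \<and> h x \<le> 1" if "x \<in> topspace X" for x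
    using B(1) B(2)[OF that] by (auto simp: h_def field_simps abs_le_iff)
  then have hL: "(LINT x|riesz. h x) = L h" by (rule unit[OF h])
  have f_eq: "f = (\<lambda>x. 2 * B * h x + - B)"
    using B by (auto simp: h_def fun_eq_iff)
  have "L f = 2 * B * L h + - B * L (\<lambda>x. 1)"
    using h by (subst f_eq, subst add) (auto simp: scale const[of "- B"])
  also have "\<dots> = (LINT x|riesz. 2 * B * h x + - B)"
    using riesz_integrable[OF h] by (simp add: hL measure_riesz_topspace)
  finally show ?thesis using f_eq by simp
qed

end

text \<open>The measure \<open>riesz\<close> of the functional sending \<open>f\<close> to
  \<open>A f x\<close> is a witness for the choice in \<open>representing_measure\<close>.\<close>

lemma representing_measure:
  assumes "compact_space X" "Hausdorff_space X" "positive_linear_operator X A" "x \<in> topspace X"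
  shows "regular_borel_measure X (representing_measure X A x)"
    and "\<And>f. f \<in> C_space X \<Longrightarrow> (LINT y|representing_measure X A x. f y) = A f x"
proof -
  interpret positive_functional X "\<lambda>f. A f x"
    by unfold_locales (use assms in \<open>auto simp: positive_linear_operator_def\<close>)
  have "\<exists>\<nu>. regular_borel_measure X \<nu> \<and> (\<forall>f\<in>C_space X. (LINT y|\<nu>. f y) = A f x)"
    using regular_riesz integral_riesz by blast
  then have "regular_borel_measure X (representing_measure X A x) \<and>
    (\<forall>f\<in>C_space X. (LINT y|representing_measure X A x. f y) = A f x)"
    unfolding representing_measure_def by (rule someI_ex)
  then show "regular_borel_measure X (representing_measure X A x)"
    "\<And>f. f \<in> C_space X \<Longrightarrow> (LINT y|representing_measure X A x. f y) = A f x" by auto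
qed

section \<open>Positive operators and their traces\<close>

lemma C_space_Tietze:
  assumes "compact_space X" "Hausdorff_space X" "closedin X Y" "f \<in> C_space (subtopology X Y)"
    and "\<And>x. x \<in> Y \<Longrightarrow> a \<le> f x \<and> f x \<le> b" "a \<le> b"
  obtains F where "F \<in> C_space X" "\<And>x. x \<in> Y \<Longrightarrow> F x = f x"
    "\<And>x. x \<in> topspace X \<Longrightarrow> a \<le> F x \<and> F x \<le> b"
proof -
  have "normal_space X"
    using assms compact_Hausdorff_or_regular_imp_normal_space by blast
  then obtain F where "continuous_map X euclideanreal F" "\<And>x. x \<in> Y \<Longrightarrow> F x = f x"
    "F ` topspace X \<subseteq> {a..b}"
    using Tietze_extension_closed_real_interval[of X Y f a b] assms
    by (auto simp: C_space_def image_subset_iff)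
  then show thesis
    by (intro that[of F]) (auto simp: C_space_def image_subset_iff)
qed

lemma positive_linear_operatorD:
  assumes "positive_linear_operator X A"
  shows "f \<in> C_space X \<Longrightarrow> A f \<in> C_space X"
    and "f \<in> C_space X \<Longrightarrow> g \<in> C_space X \<Longrightarrow> x \<in> topspace X \<Longrightarrow> A (\<lambda>y. f y + g y) x = A f x + A g x"
    and "f \<in> C_space X \<Longrightarrow> x \<in> topspace X \<Longrightarrow> A (\<lambda>y. c * f y) x = c * A f x"
    and "f \<in> C_space X \<Longrightarrow> (\<And>x. x \<in> topspace X \<Longrightarrow> 0 \<le> f x) \<Longrightarrow> x \<in> topspace X \<Longrightarrow> 0 \<le> A f x"
  using assms unfolding positive_linear_operator_def by blast+

lemma positive_linear_operator_mono:
  assumes A: "positive_linear_operator X A" and f: "f \<in> C_space X" and g: "g \<in> C_space X"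
    and le: "\<And>x. x \<in> topspace X \<Longrightarrow> f x \<le> g x" and x: "x \<in> topspace X"
  shows "A f x \<le> A g x"
proof -
  have d: "(\<lambda>y. g y - f y) \<in> C_space X" using f g by auto
  have "A g x = A (\<lambda>y. f y + (g y - f y)) x" by simp
  also have "\<dots> = A f x + A (\<lambda>y. g y - f y) x"
    by (rule positive_linear_operatorD(2)[OF A f d x])
  moreover have "0 \<le> A (\<lambda>y. g y - f y) x"
    by (rule positive_linear_operatorD(4)[OF A d _ x]) (use le in auto)
  ultimately show ?thesis by linarith
qed

text \<open>Linearity of \<open>A ^^ n\<close> is an identity on \<open>topspace X\<close> only, so
  \<open>positive_linear_operator_cong\<close> is needed to use it under a further application of
  \<open>A\<close>.\<close>

lemma positive_linear_operator_funpow: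
  assumes A: "positive_linear_operator X A"
  shows "positive_linear_operator X (A ^^ n)"
proof (induction n)
  case 0
  show ?case by (simp add: positive_linear_operator_def C_space_add C_space_mult)
next
  case (Suc n)
  note D = positive_linear_operatorD[OF A] and Dn = positive_linear_operatorD[OF Suc]
  show ?case
    unfolding positive_linear_operator_def
  proof (intro conjI ballI allI impI)
    fix f assume f: "f \<in> C_space X"
    show "(A ^^ Suc n) f \<in> C_space X" using f D Dn by simp
    fix x assume x: "x \<in> topspace X"
    show "(A ^^ Suc n) (\<lambda>y. f y + g y) x = (A ^^ Suc n) f x + (A ^^ Suc n) g x"
      if g: "g \<in> C_space X" for g
    proof -
      have "A ((A ^^ n) (\<lambda>y. f y + g y)) x = A (\<lambda>y. (A ^^ n) f y + (A ^^ n) g y) x"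
        using f g by (intro positive_linear_operator_cong[OF A _ _ _ x]) (auto intro!: Dn)
      then show ?thesis using f g x by (simp add: D Dn)
    qed
    show "(A ^^ Suc n) (\<lambda>y. c * f y) x = c * (A ^^ Suc n) f x" for c
    proof -
      have "A ((A ^^ n) (\<lambda>y. c * f y)) x = A (\<lambda>y. c * (A ^^ n) f y) x"
        using f by (intro positive_linear_operator_cong[OF A _ _ _ x]) (auto intro!: Dn)
      then show ?thesis using f x by (simp add: D Dn)
    qed
    show "0 \<le> (A ^^ Suc n) f x" if "\<forall>x\<in>topspace X. 0 \<le> f x"
      using that f x by (auto intro!: D Dn)
  qed
qed

lemma regular_measure_finite:
  "regular_borel_measure X \<nu> \<Longrightarrow> finite_measure \<nu>"
  "regular_borel_measure X \<nu> \<Longrightarrow> sets \<nu> = sets (borel_of X)"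
  unfolding regular_borel_measure_def by blast+

section \<open>The trace of a positive operator on a closed set\<close>

locale trace =
  fixes X :: "'a topology" and A :: "('a \<Rightarrow> real) \<Rightarrow> 'a \<Rightarrow> real" and Y :: "'a set"
  assumes compact: "compact_space X" and Hausdorff: "Hausdorff_space X"
    and A: "positive_linear_operator X A"
    and closed: "closedin X Y" and compatible: "compatible X A Y"
begin

abbreviation "B \<equiv> trace_operator X A Y"
abbreviation "\<nu> \<equiv> representing_measure X A"
abbreviation "CY \<equiv> C_space (subtopology X Y)"

lemma Y_subset: "Y \<subseteq> topspace X"
  using closed by (rule closedin_subset)

lemma topspace_Y: "topspace (subtopology X Y) = Y"
  using Y_subset by auto

lemma compact_Y: "compact_space (subtopology X Y)"
  using closedin_compact_space[OF compact closed] by (rule compact_space_subtopology)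

lemma nu:
  assumes "x \<in> topspace X"
  shows "regular_borel_measure X (\<nu> x)" "finite_measure (\<nu> x)" "sets (\<nu> x) = sets (borel_of X)"
    "space (\<nu> x) = topspace X" "f \<in> C_space X \<Longrightarrow> (LINT y|\<nu> x. f y) = A f x"
    "f \<in> C_space X \<Longrightarrow> integrable (\<nu> x) f"
proof -
  note R = representing_measure[OF compact Hausdorff A assms]
  show "regular_borel_measure X (\<nu> x)" "finite_measure (\<nu> x)" "sets (\<nu> x) = sets (borel_of X)"
    using R(1) by (simp_all add: regular_measure_finite)
  then show "space (\<nu> x) = topspace X" "f \<in> C_space X \<Longrightarrow> integrable (\<nu> x) f"
    using sets_eq_imp_space_eq[of "\<nu> x" "borel_of X"] by (auto intro: C_space_integrable[OF compact])
  show "f \<in> C_space X \<Longrightarrow> (LINT y|\<nu> x. f y) = A f x" by (rule R(2))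
qed

lemma CY_bounded:
  assumes "f \<in> CY"
  obtains M where "M > 0" "\<And>x. x \<in> Y \<Longrightarrow> \<bar>f x\<bar> \<le> M"
  using C_space_bounded[OF compact_Y assms] unfolding topspace_Y by metis

lemma CY_extend:
  assumes "f \<in> CY"
  obtains F where "F \<in> C_space X" "\<And>x. x \<in> Y \<Longrightarrow> F x = f x"
proof -
  obtain M where "M > 0" "\<And>x. x \<in> Y \<Longrightarrow> \<bar>f x\<bar> \<le> M"
    using CY_bounded[OF assms] by metis
  then have "\<And>x. x \<in> Y \<Longrightarrow> -M \<le> f x \<and> f x \<le> M" "-M \<le> M"
    by (auto simp: abs_le_iff minus_le_iff)
  then show thesis
    using C_space_Tietze[OF compact Hausdorff closed assms, of "-M" M] that by metis
qed

lemma restrict_CY: "f \<in> C_space X \<Longrightarrow> f \<in> CY"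
  by (rule C_space_subtopology)

text \<open>After multiplication by the indicator of \<open>Y\<close>, the function \<open>f\<close>
  coincides with a continuous extension to \<open>X\<close>, so its values off \<open>Y\<close> are
  harmless.\<close>

lemma trace_integrable:
  assumes "f \<in> CY" "x \<in> topspace X"
  shows "set_integrable (\<nu> x) Y f"
proof -
  obtain F where F: "F \<in> C_space X" "\<And>x. x \<in> Y \<Longrightarrow> F x = f x"
    using CY_extend[OF assms(1)] by metis
  have "set_integrable (\<nu> x) Y F"
    unfolding set_integrable_def using nu[OF assms(2)] closed F(1)
    by (intro integrable_mult_indicator) (auto intro: closedin_borel_of)
  then show ?thesis
    unfolding set_integrable_def
    by (rule Bochner_Integration.integrable_cong[THEN iffD1, OF refl, rotated])
       (auto simp: indicator_def F)
qed

text \<open>Compatibility supplies the continuity of \<open>B f\<close>; the remaining clauses are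
  properties of the integral over \<open>Y\<close>.\<close>

lemma positive_trace: "positive_linear_operator (subtopology X Y) B"
  unfolding positive_linear_operator_def topspace_Y
proof (intro conjI ballI allI impI)
  fix f assume f: "f \<in> CY"
  show "B f \<in> CY" using compatible f by (simp add: compatible_def)
  fix x assume "x \<in> Y"
  then have x: "x \<in> topspace X" using Y_subset by auto
  show "B (\<lambda>y. f y + g y) x = B f x + B g x" if "g \<in> CY" for g
    unfolding trace_operator_def by (rule set_integral_add(2)[OF trace_integrable trace_integrable]) fact+
  show "B (\<lambda>y. c * f y) x = c * B f x" for c
    unfolding trace_operator_def by simp
  show "0 \<le> B f x" if "\<forall>x\<in>Y. 0 \<le> f x"
    unfolding trace_operator_def set_lebesgue_integral_def
    using that by (intro integral_nonneg_AE) (auto simp: indicator_def)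
qed

text \<open>Restricting the integral of a nonnegative function to \<open>Y\<close> only discards a
  nonnegative contribution.\<close>

lemma trace_le:
  assumes "f \<in> C_space X" "\<And>x. x \<in> topspace X \<Longrightarrow> 0 \<le> f x" "x \<in> Y"
  shows "B f x \<le> A f x"
proof -
  have x: "x \<in> topspace X" using assms Y_subset by auto
  have "B f x \<le> (LINT y|\<nu> x. f y)"
    unfolding trace_operator_def set_lebesgue_integral_def
    using trace_integrable[OF restrict_CY[OF assms(1)] x] nu[OF x] assms
    by (intro integral_mono) (auto simp: set_integrable_def indicator_def)
  then show ?thesis using nu(5)[OF x assms(1)] by simp
qed

lemmas funpow_A = positive_linear_operator_funpow[OF A]
lemmas funpow_B = positive_linear_operator_funpow[OF positive_trace]
lemmas A_D = positive_linear_operatorD[OF A]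
lemmas B_D = positive_linear_operatorD[OF positive_trace, unfolded topspace_Y]
lemmas An_D = positive_linear_operatorD[OF funpow_A]
lemmas Bn_D = positive_linear_operatorD[OF funpow_B, unfolded topspace_Y]
lemmas An_mono = positive_linear_operator_mono[OF funpow_A]
lemmas Bn_mono = positive_linear_operator_mono[OF funpow_B, unfolded topspace_Y]

text \<open>Monotonicity of \<open>B\<close> carries the induction hypothesis one step further, and
  \<open>trace_le\<close> then applies to \<open>(A ^^ n) f\<close>, which is nonnegative on all of
  \<open>X\<close>.\<close>

lemma funpow_trace_le:
  assumes f: "f \<in> C_space X" "\<And>x. x \<in> topspace X \<Longrightarrow> 0 \<le> f x"
  shows "x \<in> Y \<Longrightarrow> (B ^^ n) f x \<le> (A ^^ n) f x"
proof (induction n arbitrary: x)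
  case (Suc n)
  have "B ((B ^^ n) f) x \<le> B ((A ^^ n) f) x"
    using Suc f
    by (intro positive_linear_operator_mono[OF positive_trace, unfolded topspace_Y] Bn_D(1))
       (auto intro: restrict_CY An_D(1))
  also have "\<dots> \<le> A ((A ^^ n) f) x"
    using Suc f by (intro trace_le An_D(1,4)) auto
  finally show ?case by simp
qed simp

section \<open>Cutoff functions and the one-step estimate\<close>

definition cutoffs :: "('a \<Rightarrow> real) set" where
  "cutoffs = {\<phi> \<in> C_space X. (\<forall>x\<in>topspace X. 0 \<le> \<phi> x \<and> \<phi> x \<le> 1) \<and> (\<forall>x\<in>Y. \<phi> x = 1)}"

lemma cutoffsD:
  assumes "\<phi> \<in> cutoffs"
  shows "\<phi> \<in> C_space X" "x \<in> topspace X \<Longrightarrow> 0 \<le> \<phi> x" "x \<in> topspace X \<Longrightarrow> \<phi> x \<le> 1" "x \<in> Y \<Longrightarrow> \<phi> x = 1"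
  using assms by (auto simp: cutoffs_def)

lemma cutoffs_one: "(\<lambda>x. 1) \<in> cutoffs"
  by (simp add: cutoffs_def)

lemma cutoffs_mult: "\<phi> \<in> cutoffs \<Longrightarrow> \<psi> \<in> cutoffs \<Longrightarrow> (\<lambda>x. \<phi> x * \<psi> x) \<in> cutoffs"
  by (auto simp: cutoffs_def mult_le_one)

lemma cutoffs_prod:
  "finite I \<Longrightarrow> (\<And>i. i \<in> I \<Longrightarrow> \<phi> i \<in> cutoffs) \<Longrightarrow> (\<lambda>x. \<Prod>i\<in>I. \<phi> i x) \<in> cutoffs"
proof (induction I rule: finite_induct)
  case (insert i I)
  then have "(\<lambda>x. \<phi> i x * (\<Prod>i\<in>I. \<phi> i x)) \<in> cutoffs" by (intro cutoffs_mult) auto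
  with insert show ?case by simp
qed (simp add: cutoffs_one)

lemma cutoffs_prod_le:
  assumes "finite I" "\<And>i. i \<in> I \<Longrightarrow> \<phi> i \<in> cutoffs" "j \<in> I" "x \<in> topspace X"
  shows "(\<Prod>i\<in>I. \<phi> i x) \<le> \<phi> j x"
proof -
  have "(\<Prod>i\<in>I. \<phi> i x) = \<phi> j x * (\<Prod>i\<in>I-{j}. \<phi> i x)"
    using assms by (intro prod.remove)
  also have "\<dots> \<le> \<phi> j x * 1"
    using assms cutoffsD by (intro mult_left_mono prod_le_1) auto
  finally show ?thesis by simp
qed

text \<open>An upper estimate obtained with one cutoff survives when the cutoff is made smaller;
  this is what permits products of cutoffs.\<close>

lemma funpow_cutoff_mono:
  assumes "g \<in> C_space X" "\<And>x. x \<in> topspace X \<Longrightarrow> 0 \<le> g x" "\<phi> \<in> cutoffs" "\<psi> \<in> cutoffs"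
    "\<And>x. x \<in> topspace X \<Longrightarrow> \<phi> x \<le> \<psi> x" "x \<in> topspace X"
  shows "(A ^^ n) (\<lambda>y. \<phi> y * g y) x \<le> (A ^^ n) (\<lambda>y. \<psi> y * g y) x"
  using assms by (intro An_mono) (auto intro: mult_right_mono cutoffsD)

text \<open>Outer regularity of \<open>\<nu> x\<close> yields an open \<open>U\<close> containing
  \<open>Y\<close> with \<open>U - Y\<close> of measure below \<open>e / M\<close>, where
  \<open>M\<close> bounds \<open>g\<close>. A Urysohn function equal to 1 on \<open>Y\<close> and 0
  off \<open>U\<close> then adds less than \<open>e\<close> to the integral over
  \<open>Y\<close>.\<close>

lemma cutoff_at_point:
  assumes g: "g \<in> C_space X" "\<And>x. x \<in> topspace X \<Longrightarrow> 0 \<le> g x" and x: "x \<in> Y" and e: "0 < e"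
  obtains \<phi> where "\<phi> \<in> cutoffs" "A (\<lambda>y. \<phi> y * g y) x < B g x + e"
proof -
  have xX: "x \<in> topspace X" using x Y_subset by auto
  note nu = nu[OF xX]
  interpret finite_measure "\<nu> x" by (rule nu(2))
  obtain M where M: "M > 0" "\<And>x. x \<in> topspace X \<Longrightarrow> \<bar>g x\<bar> \<le> M"
    using C_space_bounded[OF compact g(1)] by metis
  have Y: "Y \<in> sets (\<nu> x)" using closed nu(3) by (simp add: closedin_borel_of)
  have "emeasure (\<nu> x) Y = (INF U\<in>{U. openin X U \<and> Y \<subseteq> U}. emeasure (\<nu> x) U)"
    using nu(1) Y unfolding regular_borel_measure_def by blast
  then have "\<exists>U\<in>{U. openin X U \<and> Y \<subseteq> U}. emeasure (\<nu> x) U < emeasure (\<nu> x) Y + ennreal (e / M)"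
    using e M openin_topspace Y_subset by (intro INF_approx_ennreal) auto
  then obtain U where U: "openin X U" "Y \<subseteq> U" "emeasure (\<nu> x) U < emeasure (\<nu> x) Y + ennreal (e / M)"
    by auto
  have Us: "U \<in> sets (\<nu> x)" using U nu(3) by (simp add: openin_borel_of)
  have mU: "measure (\<nu> x) U < measure (\<nu> x) Y + e / M"
    using U(3) e M by (simp add: emeasure_eq_measure ennreal_less_iff flip: ennreal_plus)
  obtain \<phi> where \<phi>: "\<phi> \<in> C_space X" "\<And>x. x \<in> topspace X \<Longrightarrow> 0 \<le> \<phi> x \<and> \<phi> x \<le> 1"
    "\<And>x. x \<in> topspace X - U \<Longrightarrow> \<phi> x = 0" "\<And>x. x \<in> Y \<Longrightarrow> \<phi> x = 1"
    using C_space_Urysohn[OF compact Hausdorff _ closed, of "topspace X - U"] U by auto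
  have \<phi>c: "\<phi> \<in> cutoffs" using \<phi> by (auto simp: cutoffs_def)
  have int: "integrable (\<nu> x) (\<lambda>y. indicator Y y *\<^sub>R g y)"
    using trace_integrable[OF restrict_CY[OF g(1)] xX] by (simp add: set_integrable_def)
  have intU: "integrable (\<nu> x) (\<lambda>y. M * indicator (U - Y) y)"
    using Us Y by (intro integrable_mult_right integrable_real_indicator) (auto simp: less_top[symmetric])
  have "A (\<lambda>y. \<phi> y * g y) x = (LINT y|\<nu> x. \<phi> y * g y)"
    using nu(5)[of "\<lambda>y. \<phi> y * g y"] \<phi>(1) g(1) by (simp add: C_space_mult)
  also have "\<dots> \<le> (LINT y|\<nu> x. indicator Y y *\<^sub>R g y + M * indicator (U - Y) y)"
  proof (rule integral_mono)
    show "integrable (\<nu> x) (\<lambda>y. \<phi> y * g y)" by (intro nu(6) C_space_mult \<phi> g)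
    show "integrable (\<nu> x) (\<lambda>y. indicator Y y *\<^sub>R g y + M * indicator (U - Y) y)"
      using int intU by auto
    fix y assume "y \<in> space (\<nu> x)"
    then have y: "y \<in> topspace X" by (simp add: nu(4))
    consider "y \<in> Y" | "y \<in> U - Y" | "y \<notin> U" by blast
    then show "\<phi> y * g y \<le> indicator Y y *\<^sub>R g y + M * indicator (U - Y) y"
    proof cases
      case 2
      have "\<phi> y * g y \<le> 1 * M"
        using \<phi>(2)[OF y] M(2)[OF y] g(2)[OF y] by (intro mult_mono) auto
      with 2 show ?thesis by simp
    qed (use \<phi> y U in \<open>auto simp: indicator_def\<close>)
  qed
  also have "\<dots> = B g x + M * measure (\<nu> x) (U - Y)"
    using int intU Us Y U nu(4) openin_subset[OF U(1)]
    by (simp add: trace_operator_def set_lebesgue_integral_def Int_absorb2 Diff_subset[THEN subset_trans])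
  also have "\<dots> < B g x + e"
    using mU M(1) Us Y U(2) by (simp add: finite_measure_Diff field_simps)
  finally show thesis using that \<phi>c by blast
qed

text \<open>Dini's argument: continuity of the trace lets a finite product of pointwise good cutoffs
  work on all of \<open>Y\<close>.\<close>

lemma cutoff_step:
  assumes g: "g \<in> C_space X" "\<And>x. x \<in> topspace X \<Longrightarrow> 0 \<le> g x" and e: "0 < e"
  obtains \<phi> where "\<phi> \<in> cutoffs" "\<And>x. x \<in> Y \<Longrightarrow> A (\<lambda>y. \<phi> y * g y) x \<le> B g x + e"
proof -
  have "\<exists>\<phi>. \<phi> \<in> cutoffs \<and> A (\<lambda>y. \<phi> y * g y) x < B g x + e" if "x \<in> Y" for x
    using cutoff_at_point[OF g that e] by metis
  then obtain \<phi> where \<phi>: "\<And>x. x \<in> Y \<Longrightarrow> \<phi> x \<in> cutoffs"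
    "\<And>x. x \<in> Y \<Longrightarrow> A (\<lambda>y. \<phi> x y * g y) x < B g x + e"
    by metis
  define V where "V x = {z \<in> Y. A (\<lambda>y. \<phi> x y * g y) z - B g z < e}" for x
  have V: "openin (subtopology X Y) (V x)" if "x \<in> Y" for x
  proof -
    have "(\<lambda>z. A (\<lambda>y. \<phi> x y * g y) z - B g z) \<in> CY"
      using \<phi>(1)[OF that] g(1)
      by (intro C_space_diff restrict_CY[OF A_D(1)] B_D(1)[OF restrict_CY] C_space_mult)
         (auto intro: cutoffsD)
    from C_space_open_less[OF this, of e] show ?thesis unfolding topspace_Y V_def .
  qed
  have "Y \<subseteq> \<Union>(V ` Y)"
    using \<phi>(2) by (fastforce simp: V_def)
  then obtain F where F: "finite F" "F \<subseteq> V ` Y" "Y \<subseteq> \<Union>F"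
    using compactinD[OF compact_Y[unfolded compact_space_def topspace_Y], of "V ` Y"] V by blast
  then obtain I where I: "finite I" "I \<subseteq> Y" "F = V ` I"
    by (meson finite_subset_image)
  define \<psi> where "\<psi> y = (\<Prod>x\<in>I. \<phi> x y)" for y
  have \<psi>: "\<psi> \<in> cutoffs"
    unfolding \<psi>_def using I \<phi>(1) by (intro cutoffs_prod) auto
  show thesis
  proof (rule that[OF \<psi>])
    fix z assume z: "z \<in> Y"
    then obtain x where x: "x \<in> I" "z \<in> V x" using F(3) I(3) by auto
    \<comment> \<open>The power \<open>A ^^ 1\<close> is just \<open>A\<close>, written so that
      \<open>funpow_cutoff_mono\<close> matches.\<close>
    have "(A ^^ 1) (\<lambda>y. \<psi> y * g y) z \<le> (A ^^ 1) (\<lambda>y. \<phi> x y * g y) z"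
    proof (rule funpow_cutoff_mono[OF g \<psi>])
      show "\<phi> x \<in> cutoffs" using x I \<phi>(1) by auto
      show "\<psi> y \<le> \<phi> x y" if "y \<in> topspace X" for y
        unfolding \<psi>_def using I x \<phi>(1) that by (intro cutoffs_prod_le) auto
      show "z \<in> topspace X" using z Y_subset by auto
    qed
    then show "A (\<lambda>y. \<psi> y * g y) z \<le> B g z + e" using x by (simp add: V_def)
  qed
qed

end

section \<open>Iterating the cutoff estimate by means of the transfer identity\<close>

locale compatible_transfer = trace +
  fixes \<alpha> :: "'a \<Rightarrow> 'a"
  assumes transfer: "transfer_operator X \<alpha> A" and cont: "continuous_map X X \<alpha>"
    and forward: "\<alpha> ` Y \<subseteq> Y"
begin

lemma transfer_mult:
  "f \<in> C_space X \<Longrightarrow> g \<in> C_space X \<Longrightarrow> x \<in> topspace X \<Longrightarrow> A (\<lambda>y. f (\<alpha> y) * g y) x = f x * A g x"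
  using transfer by (simp add: transfer_operator_def)

text \<open>The induction must range over all \<open>g\<close>, since its hypothesis is applied to
  \<open>k = A (\<lambda>y. \<phi> y * g y)\<close>. The transfer identity turns one application of
  \<open>A\<close> to \<open>\<psi> (\<alpha> y) * \<phi> y * g y\<close> into
  \<open>\<psi> * k\<close>.\<close>

lemma cutoff_funpow:
  assumes "g \<in> C_space X" "\<And>x. x \<in> topspace X \<Longrightarrow> 0 \<le> g x" and "0 < e"
  shows "\<exists>\<phi>\<in>cutoffs. \<forall>x\<in>Y. (A ^^ n) (\<lambda>y. \<phi> y * g y) x \<le> (B ^^ n) g x + e"
  using assms
proof (induction n arbitrary: g e)
  case 0
  then show ?case using cutoffs_one by (intro bexI[of _ "\<lambda>x. 1"]) auto
next
  case (Suc n)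
  note g = Suc.prems(1,2)
  have one: "(\<lambda>x. 1) \<in> CY" by simp
  obtain M where M: "M > 0" "\<And>x. x \<in> Y \<Longrightarrow> \<bar>(B ^^ n) (\<lambda>x. 1) x\<bar> \<le> M"
    using CY_bounded[OF Bn_D(1)[OF one]] by metis
  \<comment> \<open>On \<open>Y\<close> one has \<open>k \<le> B g + d\<close>, and applying
    \<open>B ^^ n\<close> multiplies the error \<open>d\<close> by at most \<open>M\<close>. This
    uses half of \<open>e\<close>; the other half is spent on \<open>\<psi>\<close>.\<close>
  define d where "d = e / (2 * M)"
  have d: "d > 0" using Suc.prems M by (simp add: d_def)
  obtain \<phi> where \<phi>: "\<phi> \<in> cutoffs" "\<And>x. x \<in> Y \<Longrightarrow> A (\<lambda>y. \<phi> y * g y) x \<le> B g x + d"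
    using cutoff_step[OF g d] by metis
  define k where "k = A (\<lambda>y. \<phi> y * g y)"
  have \<phi>g: "(\<lambda>y. \<phi> y * g y) \<in> C_space X" using \<phi>(1) g(1) by (intro C_space_mult) (auto intro: cutoffsD)
  have k: "k \<in> C_space X" "\<And>x. x \<in> topspace X \<Longrightarrow> 0 \<le> k x"
    unfolding k_def using \<phi>(1) g
    by (auto intro!: A_D(1)[OF \<phi>g] A_D(4)[OF \<phi>g] mult_nonneg_nonneg intro: cutoffsD(2))
  obtain \<psi> where \<psi>: "\<psi> \<in> cutoffs" "\<And>x. x \<in> Y \<Longrightarrow> (A ^^ n) (\<lambda>y. \<psi> y * k y) x \<le> (B ^^ n) k x + e / 2"
    using Suc.IH[OF k, of "e / 2"] Suc.prems(3) by auto
  have \<alpha>X: "\<alpha> x \<in> topspace X" if "x \<in> topspace X" for x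
    using cont that by (auto simp: continuous_map_def)
  have \<psi>\<alpha>: "(\<lambda>y. \<psi> (\<alpha> y)) \<in> cutoffs"
    using \<psi>(1) forward \<alpha>X continuous_map_compose[OF cont, of euclideanreal \<psi>]
    by (auto simp: cutoffs_def C_space_def o_def)
  have \<theta>: "(\<lambda>y. \<psi> (\<alpha> y) * \<phi> y) \<in> cutoffs"
    by (rule cutoffs_mult[OF \<psi>\<alpha> \<phi>(1)])
  show ?case
  proof (intro bexI[OF _ \<theta>] ballI)
    fix x assume x: "x \<in> Y"
    then have xX: "x \<in> topspace X" using Y_subset by auto
    have "(A ^^ Suc n) (\<lambda>y. \<psi> (\<alpha> y) * \<phi> y * g y) x = (A ^^ n) (A (\<lambda>y. \<psi> (\<alpha> y) * (\<phi> y * g y))) x"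
      by (simp only: funpow_Suc_right o_apply mult.assoc)
    also have "\<dots> = (A ^^ n) (\<lambda>y. \<psi> y * k y) x"
    proof (rule positive_linear_operator_cong[OF funpow_A _ _ _ xX])
      show "A (\<lambda>y. \<psi> (\<alpha> y) * (\<phi> y * g y)) \<in> C_space X"
        using \<phi>g cutoffsD(1)[OF \<psi>\<alpha>] by (intro A_D(1) C_space_mult[of _ X "\<lambda>y. \<phi> y * g y"])
      show "(\<lambda>y. \<psi> y * k y) \<in> C_space X"
        using k cutoffsD(1)[OF \<psi>(1)] by (intro C_space_mult)
      show "A (\<lambda>y. \<psi> (\<alpha> y) * (\<phi> y * g y)) z = \<psi> z * k z" if "z \<in> topspace X" for z
        unfolding k_def using transfer_mult[OF cutoffsD(1)[OF \<psi>(1)] \<phi>g that] .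
    qed
    also have "\<dots> \<le> (B ^^ n) k x + e / 2" by (rule \<psi>(2)[OF x])
    also have "(B ^^ n) k x \<le> (B ^^ n) (\<lambda>y. B g y + d * 1) x"
      using \<phi>(2) x restrict_CY[OF g(1)] restrict_CY[OF k(1)]
      by (intro Bn_mono C_space_add B_D) (auto simp: k_def)
    also have "(B ^^ n) (\<lambda>y. B g y + d * 1) x = (B ^^ n) (B g) x + (B ^^ n) (\<lambda>y. d * 1) x"
      using x restrict_CY[OF g(1)] by (intro Bn_D(2) B_D) auto
    also have "(B ^^ n) (\<lambda>y. d * 1) x = d * (B ^^ n) (\<lambda>y. 1) x"
      using x by (intro Bn_D(3)) auto
    also have "d * (B ^^ n) (\<lambda>y. 1) x \<le> d * M"
      using d M(2)[OF x] by (intro mult_left_mono) auto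
    also have "d * M = e / 2" using M by (simp add: d_def)
    finally show "(A ^^ Suc n) (\<lambda>y. \<psi> (\<alpha> y) * \<phi> y * g y) x \<le> (B ^^ Suc n) g x + e"
      by (simp add: funpow_Suc_right del: funpow.simps)
  qed
qed

text \<open>The product of the cutoffs for the individual \<open>g i\<close> lies below each of
  them, so it serves all members at once.\<close>

lemma cutoff_family:
  fixes k :: nat
  assumes g: "\<And>i. i < k \<Longrightarrow> g i \<in> C_space X" "\<And>i x. i < k \<Longrightarrow> x \<in> topspace X \<Longrightarrow> 0 \<le> g i x"
    and e: "0 < e"
  obtains \<phi> where "\<phi> \<in> cutoffs"
    "\<And>i x. i < k \<Longrightarrow> x \<in> Y \<Longrightarrow> (A ^^ n) (\<lambda>y. \<phi> y * g i y) x \<le> (B ^^ n) (g i) x + e"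
proof -
  have "\<exists>\<phi>\<in>cutoffs. \<forall>x\<in>Y. (A ^^ n) (\<lambda>y. \<phi> y * g i y) x \<le> (B ^^ n) (g i) x + e" if "i < k" for i
    using cutoff_funpow g that e by simp
  then obtain \<phi> where \<phi>: "\<And>i. i < k \<Longrightarrow> \<phi> i \<in> cutoffs"
    "\<And>i x. i < k \<Longrightarrow> x \<in> Y \<Longrightarrow> (A ^^ n) (\<lambda>y. \<phi> i y * g i y) x \<le> (B ^^ n) (g i) x + e"
    by metis
  have \<psi>: "(\<lambda>y. \<Prod>i<k. \<phi> i y) \<in> cutoffs"
    by (intro cutoffs_prod) (auto intro: \<phi>(1))
  show thesis
  proof (rule that[OF \<psi>])
    fix i x assume i: "i < k" and x: "x \<in> Y"
    have "(A ^^ n) (\<lambda>y. (\<Prod>i<k. \<phi> i y) * g i y) x \<le> (A ^^ n) (\<lambda>y. \<phi> i y * g i y) x"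
      using g i x \<phi>(1) Y_subset \<psi> by (intro funpow_cutoff_mono cutoffs_prod_le) auto
    also have "\<dots> \<le> (B ^^ n) (g i) x + e" by (rule \<phi>(2)[OF i x])
    finally show "(A ^^ n) (\<lambda>y. (\<Prod>i<k. \<phi> i y) * g i y) x \<le> (B ^^ n) (g i) x + e" .
  qed
qed

end

section \<open>Entropy of partitions\<close>

definition entropy_value :: "real \<Rightarrow> real \<Rightarrow> ereal" where
  "entropy_value p q = (if p = 0 then 0 else ereal p * ext_ln (q / p))"

lemma entropy_term_eq: "entropy_term \<mu> g h = entropy_value (LINT x|\<mu>. g x) (LINT x|\<mu>. h x)"
  by (simp add: entropy_term_def entropy_value_def)

lemma ext_ln_mono: "0 \<le> r \<Longrightarrow> r \<le> s \<Longrightarrow> ext_ln r \<le> ext_ln s"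
  by (auto simp: ext_ln_def)

text \<open>A function on \<open>X\<close> and its restriction to \<open>Y\<close> have the same
  integral \<open>p\<close>, so comparing entropy summands comes down to comparing the second
  integrals.\<close>

lemma entropy_value_mono:
  "0 \<le> p \<Longrightarrow> 0 \<le> q \<Longrightarrow> q \<le> q' \<Longrightarrow> entropy_value p q \<le> entropy_value p q'"
  by (auto simp: entropy_value_def intro!: ereal_mult_left_mono ext_ln_mono divide_right_mono)

text \<open>Summands may be -\<infinity>. Excluding \<infinity> keeps addition in
  \<open>ereal\<close> continuous at the limits taken below.\<close>

lemma entropy_value_not_PInf: "0 \<le> p \<Longrightarrow> entropy_value p q \<noteq> \<infinity>"
  by (auto simp: entropy_value_def ext_ln_def)

lemma sum_entropy_value_not_PInf:
  "(\<And>i. i < k \<Longrightarrow> 0 \<le> p i) \<Longrightarrow> (\<Sum>i<k. entropy_value (p i) (q i)) \<noteq> \<infinity>" for k :: nat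
  by (auto simp: sum_Pinfty entropy_value_not_PInf)

text \<open>At \<open>r = 0\<close> the value is \<open>ln (c * e)\<close>, which tends to
  -\<infinity> as \<open>e\<close> decreases to 0; for \<open>r > 0\<close> this is continuity of
  \<open>ln\<close>. The limit is one-sided because the cutoff errors are positive.\<close>

lemma ext_ln_right_continuous:
  assumes "0 \<le> r" "0 < c"
  shows "((\<lambda>e. ext_ln (r + c * e)) \<longlongrightarrow> ext_ln r) (at_right 0)"
proof (cases "r = 0")
  case True
  have "filterlim (\<lambda>e. c * e) (at_right 0) (at_right (0::real))"
    using filterlim_times_pos[of "\<lambda>e. e" 0 "at_right 0" c 0] assms(2) by (simp add: filterlim_ident)
  then have "filterlim (\<lambda>e. ln (c * e)) at_bot (at_right (0::real))"
    using ln_at_0 by (rule filterlim_compose[rotated])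
  then have "((\<lambda>e. ereal (ln (c * e))) \<longlongrightarrow> -\<infinity>) (at_right 0)"
    by (simp add: tendsto_MInfty filterlim_at_bot_dense)
  moreover have "\<forall>\<^sub>F e in at_right 0. ereal (ln (c * e)) = ext_ln (r + c * e)"
    using eventually_at_right_less[of 0] by eventually_elim (use assms True in \<open>auto simp: ext_ln_def\<close>)
  ultimately show ?thesis
    using True by (auto simp: ext_ln_def intro: Lim_transform_eventually)
next
  case False
  then have r: "r > 0" using assms by simp
  have "((\<lambda>e. ln (r + c * e)) \<longlongrightarrow> ln (r + c * 0)) (at_right 0)"
    using r by (intro tendsto_intros) auto
  then have "((\<lambda>e. ereal (ln (r + c * e))) \<longlongrightarrow> ext_ln r) (at_right 0)"
    using r by (auto simp: ext_ln_def)
  moreover have "\<forall>\<^sub>F e in at_right 0. ereal (ln (r + c * e)) = ext_ln (r + c * e)"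
    using eventually_at_right_less[of 0]
  proof eventually_elim
    case (elim e)
    then have "r + c * e > 0" using assms r by (intro add_pos_pos) auto
    then show ?case by (auto simp: ext_ln_def)
  qed
  ultimately show ?thesis by (rule Lim_transform_eventually)
qed

lemma entropy_value_right_continuous:
  assumes "0 \<le> p" "0 \<le> q"
  shows "((\<lambda>e. entropy_value p (q + e)) \<longlongrightarrow> entropy_value p q) (at_right 0)"
proof (cases "p = 0")
  case False
  have "((\<lambda>e. ereal p * ext_ln (q / p + 1 / p * e)) \<longlongrightarrow> ereal p * ext_ln (q / p)) (at_right 0)"
    using assms False by (intro tendsto_cmult_ereal ext_ln_right_continuous) auto
  then show ?thesis using False by (simp add: entropy_value_def add_divide_distrib)
qed (simp add: entropy_value_def)

lemma sum_entropy_value_right_continuous: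
  fixes k :: nat
  assumes "\<And>i. i < k \<Longrightarrow> 0 \<le> p i" "\<And>i. i < k \<Longrightarrow> 0 \<le> q i"
  shows "((\<lambda>e. \<Sum>i<k. entropy_value (p i) (q i + e)) \<longlongrightarrow> (\<Sum>i<k. entropy_value (p i) (q i))) (at_right 0)"
  using assms
proof (induction k)
  case (Suc k)
  show ?case
    unfolding sum.lessThan_Suc
    using Suc entropy_value_not_PInf[of "p k" "q k"] sum_entropy_value_not_PInf[of k p q]
    by (intro tendsto_add_ereal_general entropy_value_right_continuous) auto
qed simp

lemma partition_of_unityD:
  assumes "partition_of_unity X k g" "i < k"
  shows "g i \<in> C_space X" "x \<in> topspace X \<Longrightarrow> 0 \<le> g i x" "x \<in> topspace X \<Longrightarrow> g i x \<le> 1"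
proof -
  show 1: "g i \<in> C_space X" "x \<in> topspace X \<Longrightarrow> 0 \<le> g i x"
    using assms by (auto simp: partition_of_unity_def)
  assume x: "x \<in> topspace X"
  have "g i x \<le> (\<Sum>i<k. g i x)"
    by (rule member_le_sum) (use assms x in \<open>auto simp: partition_of_unity_def\<close>)
  then show "g i x \<le> 1" using assms x by (simp add: partition_of_unity_def)
qed

lemma integral_extend_measure_to:
  assumes "sets \<mu> = sets (borel_of (subtopology X Y))" "f \<in> C_space X"
  shows "(LINT x|extend_measure_to X \<mu>. f x) = (LINT x|\<mu>. f x)"
  unfolding extend_measure_to_def
proof (rule integral_distr)
  have "(\<lambda>x. x) \<in> borel_of (subtopology X Y) \<rightarrow>\<^sub>M borel_of X"
    by (intro continuous_map_borel_of) (simp add: continuous_map_from_subtopology)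
  then show "(\<lambda>x. x) \<in> \<mu> \<rightarrow>\<^sub>M borel_of X"
    by (simp add: measurable_cong_sets[OF assms(1) refl])
qed (rule C_space_measurable[OF assms(2)])

section \<open>Extending partitions of unity from the closed set\<close>

context trace
begin

text \<open>Tietze extends the members separately, so their sum may exceed 1 off \<open>Y\<close>.
  Division by the maximum of 1 and the sum repairs this and changes nothing on \<open>Y\<close>,
  where the sum is 1.\<close>

lemma partition_extend:
  assumes h: "partition_of_unity (subtopology X Y) k h"
  obtains g where "\<And>i. i < k \<Longrightarrow> g i \<in> C_space X"
    "\<And>i x. i < k \<Longrightarrow> x \<in> topspace X \<Longrightarrow> 0 \<le> g i x"
    "\<And>x. x \<in> topspace X \<Longrightarrow> (\<Sum>i<k. g i x) \<le> 1"
    "\<And>i x. i < k \<Longrightarrow> x \<in> Y \<Longrightarrow> g i x = h i x"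
proof -
  note hD = partition_of_unityD[OF h, unfolded topspace_Y]
  have "\<exists>G. G \<in> C_space X \<and> (\<forall>x\<in>topspace X. 0 \<le> G x) \<and> (\<forall>x\<in>Y. G x = h i x)" if "i < k" for i
    using C_space_Tietze[OF compact Hausdorff closed hD(1)[OF that], of 0 1] hD(2,3)[OF that]
    by (metis zero_le_one)
  then obtain G where G: "\<And>i. i < k \<Longrightarrow> G i \<in> C_space X"
    "\<And>i x. i < k \<Longrightarrow> x \<in> topspace X \<Longrightarrow> 0 \<le> G i x" "\<And>i x. i < k \<Longrightarrow> x \<in> Y \<Longrightarrow> G i x = h i x"
    by metis
  define S where "S x = max 1 (\<Sum>i<k. G i x)" for x
  have S: "S \<in> C_space X" "\<And>x. S x \<ge> 1"
    unfolding S_def using G by auto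
  have S1: "S x = 1" if "x \<in> Y" for x
    using h that unfolding partition_of_unity_def topspace_Y by (simp add: S_def G(3))
  show thesis
  proof (rule that[of "\<lambda>i x. G i x / S x"])
    show "(\<lambda>x. G i x / S x) \<in> C_space X" if "i < k" for i
      using G(1)[OF that] S unfolding C_space_def
      by (auto intro!: continuous_map_real_divide) (metis not_one_le_zero)
    show "0 \<le> G i x / S x" if "i < k" "x \<in> topspace X" for i x
      using G(2)[OF that] S(2)[of x] by simp
    show "(\<Sum>i<k. G i x / S x) \<le> 1" if "x \<in> topspace X" for x
      using S(2)[of x] unfolding sum_divide_distrib[symmetric] by (simp add: S_def divide_le_eq)
    show "G i x / S x = h i x" if "i < k" "x \<in> Y" for i x
      using that by (simp add: S1 G(3))
  qed
qed

end

section \<open>Comparison of the entropies of the operator and its trace\<close>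

context compatible_transfer
begin

text \<open>The inner infima over partitions already agree for each \<open>n\<close> separately;
  this is proved by two inequalities.\<close>

lemma t_entropy_trace:
  assumes \<mu>: "prob_space \<mu>" "sets \<mu> = sets (borel_of (subtopology X Y))"
  shows "t_entropy X A (extend_measure_to X \<mu>) = t_entropy (subtopology X Y) B \<mu>"
proof -
  interpret prob_space \<mu> by fact
  have space: "space \<mu> = Y"
    using sets_eq_imp_space_eq[OF \<mu>(2)] by (simp only: space_borel_of topspace_Y)
  note ext = integral_extend_measure_to[OF \<mu>(2)]
  have int: "integrable \<mu> f" if "f \<in> CY" for f
    by (rule C_space_integrable[OF compact_Y _ \<mu>(2) that]) unfold_locales
  have mono: "(LINT x|\<mu>. f x) \<le> (LINT x|\<mu>. g x)" if "f \<in> CY" "g \<in> CY" "\<And>x. x \<in> Y \<Longrightarrow> f x \<le> g x" for f g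
    using that by (intro integral_mono int) (auto simp: space)
  have nonneg: "0 \<le> (LINT x|\<mu>. f x)" if "\<And>x. x \<in> Y \<Longrightarrow> 0 \<le> f x" for f :: "'a \<Rightarrow> real"
    using that by (intro Bochner_Integration.integral_nonneg) (auto simp: space)
  have cong: "(LINT x|\<mu>. f x) = (LINT x|\<mu>. g x)" if "\<And>x. x \<in> Y \<Longrightarrow> f x = g x" for f g :: "'a \<Rightarrow> real"
    using that by (intro Bochner_Integration.integral_cong) (auto simp: space)
  let ?H = "\<lambda>n (k, g). \<Sum>i<k. entropy_term (extend_measure_to X \<mu>) (g i) ((A ^^ n) (g i))"
  let ?K = "\<lambda>n (k, g). \<Sum>i<k. entropy_term \<mu> (g i) ((B ^^ n) (g i))"
  let ?P = "{(k, g). partition_of_unity X k g}"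
  let ?Q = "{(k, g). partition_of_unity (subtopology X Y) k g}"
  have "(INF p\<in>?P. ?H n p) = (INF p\<in>?Q. ?K n p)" for n
  proof (rule antisym)
    show "(INF p\<in>?Q. ?K n p) \<le> (INF p\<in>?P. ?H n p)"
    proof (rule INF_mono)
      fix P assume "P \<in> ?P"
      then obtain k g where P: "P = (k, g)" and g: "partition_of_unity X k g" by auto
      then have gQ: "partition_of_unity (subtopology X Y) k g"
        using Y_subset by (auto simp: partition_of_unity_def restrict_CY)
      have "?K n (k, g) \<le> ?H n (k, g)"
        unfolding prod.case entropy_term_eq
      proof (intro sum_mono)
        fix i assume "i \<in> {..<k}"
        then have i: "i < k" by simp
        note gi = partition_of_unityD[OF g i]
        have "(LINT x|\<mu>. (B ^^ n) (g i) x) \<le> (LINT x|\<mu>. (A ^^ n) (g i) x)"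
          using gi by (intro mono restrict_CY Bn_D(1) An_D(1) funpow_trace_le) auto
        moreover have "0 \<le> (LINT x|\<mu>. (B ^^ n) (g i) x)"
          using gi(1,2) Y_subset by (intro nonneg Bn_D(4) restrict_CY) auto
        moreover have "0 \<le> (LINT x|\<mu>. g i x)"
          using gi(2) Y_subset by (intro nonneg) auto
        ultimately show "entropy_value (LINT x|\<mu>. g i x) (LINT x|\<mu>. (B ^^ n) (g i) x)
            \<le> entropy_value (LINT x|extend_measure_to X \<mu>. g i x) (LINT x|extend_measure_to X \<mu>. (A ^^ n) (g i) x)"
          using gi(1) by (simp add: ext An_D(1) entropy_value_mono)
      qed
      with gQ show "\<exists>p\<in>?Q. ?K n p \<le> ?H n P"
        unfolding P by (intro bexI[of _ "(k, g)"]) auto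
    qed
    show "(INF p\<in>?P. ?H n p) \<le> (INF p\<in>?Q. ?K n p)"
    proof (rule INF_greatest)
      fix Q assume "Q \<in> ?Q"
      then obtain k h where Q: "Q = (k, h)" and h: "partition_of_unity (subtopology X Y) k h" by auto
      note hD = partition_of_unityD[OF h, unfolded topspace_Y]
      obtain g where g: "\<And>i. i < k \<Longrightarrow> g i \<in> C_space X"
        "\<And>i x. i < k \<Longrightarrow> x \<in> topspace X \<Longrightarrow> 0 \<le> g i x"
        "\<And>x. x \<in> topspace X \<Longrightarrow> (\<Sum>i<k. g i x) \<le> 1"
        "\<And>i x. i < k \<Longrightarrow> x \<in> Y \<Longrightarrow> g i x = h i x"
        using partition_extend[OF h] by metis
      define p where "p i = (LINT x|\<mu>. h i x)" for i
      define q where "q i = (LINT x|\<mu>. (B ^^ n) (h i) x)" for i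
      have p: "0 \<le> p i" if "i < k" for i
        unfolding p_def using hD(2)[OF that] by (rule nonneg)
      have q: "0 \<le> q i" if "i < k" for i
        unfolding q_def using hD[OF that] by (intro nonneg Bn_D(4)) auto
      \<comment> \<open>The partition on \<open>X\<close> depends on \<open>e\<close>, but the
        infimum does not, so \<open>e\<close> may tend to 0 afterwards. The limit also covers
        \<open>q i = 0\<close>, where the summand can be -\<infinity>.\<close>
      have "(INF p\<in>?P. ?H n p) \<le> (\<Sum>i<k. entropy_value (p i) (q i + e))" if e: "0 < e" for e
      proof -
        obtain \<phi> where \<phi>: "\<phi> \<in> cutoffs"
          "\<And>i x. i < k \<Longrightarrow> x \<in> Y \<Longrightarrow> (A ^^ n) (\<lambda>y. \<phi> y * g i y) x \<le> (B ^^ n) (g i) x + e"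
          using cutoff_family[of k g e n, OF g(1,2) e] by blast
        note \<phi>D = cutoffsD[OF \<phi>(1)]
        \<comment> \<open>The member with index \<open>k\<close> completes the sum to 1. It is
          nonnegative because both \<open>\<phi>\<close> and the sum of the \<open>g i\<close> are
          at most 1, and it vanishes on \<open>Y\<close>, where both equal 1.\<close>
        define g' where "g' i x = (if i < k then \<phi> x * g i x else 1 - \<phi> x * (\<Sum>i<k. g i x))" for i x
        have g'_eq: "g' i = (\<lambda>x. \<phi> x * g i x)" if "i < k" for i
          using that by (simp add: g'_def fun_eq_iff)
        have g'_k: "g' k = (\<lambda>x. 1 - \<phi> x * (\<Sum>i<k. g i x))"
          by (simp add: g'_def fun_eq_iff)
        have "partition_of_unity X (Suc k) g'"
          unfolding partition_of_unity_def
        proof (intro conjI allI impI ballI)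
          fix i assume "i < Suc k"
          then have i: "i < k \<or> i = k" by auto
          show "g' i \<in> C_space X"
            using i g(1) \<phi>D(1) by (auto simp: g'_eq g'_k)
          show "0 \<le> g' i x" if x: "x \<in> topspace X" for x
          proof (cases "i < k")
            case True
            then show ?thesis using g(2) \<phi>D(2) x by (simp add: g'_eq)
          next
            case False
            have "0 \<le> (\<Sum>i<k. g i x)" using g(2) x by (intro sum_nonneg) auto
            then have "\<phi> x * (\<Sum>i<k. g i x) \<le> 1" using g(3) \<phi>D(2,3) x by (intro mult_le_one) auto
            then show ?thesis using False i by (simp add: g'_k)
          qed
        next
          show "(\<Sum>i<Suc k. g' i x) = 1" for x
            by (simp add: g'_k g'_eq sum_distrib_left)
        qed
        then have "(INF p\<in>?P. ?H n p) \<le> ?H n (Suc k, g')"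
          by (intro INF_lower) auto
        \<comment> \<open>The last member has integral 0, so the default value 0 of
          \<open>entropy_term\<close> removes it, whatever the integral of
          \<open>(A ^^ n) (g' k)\<close> is.\<close>
        also have "\<dots> = (\<Sum>i<k. entropy_term (extend_measure_to X \<mu>) (g' i) ((A ^^ n) (g' i)))"
        proof -
          have "g' k \<in> C_space X" using g(1) \<phi>D(1) by (auto simp: g'_k)
          then have "(LINT x|extend_measure_to X \<mu>. g' k x) = (LINT x|\<mu>. g' k x)" by (rule ext)
          also have "\<dots> = (LINT x|\<mu>. 0)"
            using h unfolding partition_of_unity_def topspace_Y by (intro cong) (simp add: g'_k \<phi>D(4) g(4))
          finally show ?thesis by (simp add: entropy_term_def)
        qed
        also have "\<dots> \<le> (\<Sum>i<k. entropy_value (p i) (q i + e))"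
          unfolding entropy_term_eq
        proof (intro sum_mono)
          fix i assume "i \<in> {..<k}"
          then have i: "i < k" by simp
          have C: "g' i \<in> C_space X" using i g(1) \<phi>D(1) by (auto simp: g'_eq)
          have pos: "0 \<le> g' i x" if "x \<in> topspace X" for x
            using i g(2) \<phi>D(2) that by (simp add: g'_eq)
          have "(LINT x|\<mu>. g' i x) = p i"
            unfolding p_def using i by (intro cong) (simp add: g'_eq \<phi>D(4) g(4))
          moreover have "(LINT x|\<mu>. (A ^^ n) (g' i) x) \<le> q i + e"
          proof -
            have "(LINT x|\<mu>. (A ^^ n) (g' i) x) \<le> (LINT x|\<mu>. (B ^^ n) (h i) x + e)"
            proof (rule mono)
              show "(A ^^ n) (g' i) \<in> CY" by (intro restrict_CY An_D(1) C)
              show "(\<lambda>x. (B ^^ n) (h i) x + e) \<in> CY" using hD(1)[OF i] by (intro C_space_add Bn_D(1)) auto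
              fix x assume x: "x \<in> Y"
              \<comment> \<open>Powers of \<open>B\<close> see only the values on \<open>Y\<close>,
                where the extension \<open>g i\<close> agrees with \<open>h i\<close>.\<close>
              have "(B ^^ n) (g i) x = (B ^^ n) (h i) x"
                using positive_linear_operator_cong[OF funpow_B restrict_CY[OF g(1)[OF i]] hD(1)[OF i], of x n] x g(4)[OF i]
                by (simp add: topspace_Y del: topspace_subtopology)
              then show "(A ^^ n) (g' i) x \<le> (B ^^ n) (h i) x + e"
                using \<phi>(2)[OF i x] by (simp add: g'_eq i)
            qed
            also have "\<dots> = q i + e"
              using int[OF Bn_D(1)[OF hD(1)[OF i]]] by (simp add: q_def prob_space)
            finally show ?thesis .
          qed
          moreover have "0 \<le> (LINT x|\<mu>. (A ^^ n) (g' i) x)"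
            using C pos Y_subset by (intro nonneg An_D(4)) auto
          ultimately show "entropy_value (LINT x|extend_measure_to X \<mu>. g' i x)
              (LINT x|extend_measure_to X \<mu>. (A ^^ n) (g' i) x) \<le> entropy_value (p i) (q i + e)"
            using C p[OF i] by (simp add: ext An_D(1) entropy_value_mono)
        qed
        finally show ?thesis .
      qed
      then have "\<forall>\<^sub>F e in at_right 0. (INF p\<in>?P. ?H n p) \<le> (\<Sum>i<k. entropy_value (p i) (q i + e))"
        by (intro eventually_at_rightI[of 0 1]) auto
      with sum_entropy_value_right_continuous[OF p q]
      have "(INF p\<in>?P. ?H n p) \<le> (\<Sum>i<k. entropy_value (p i) (q i))"
        by (rule tendsto_lowerbound) auto
      then show "(INF p\<in>?P. ?H n p) \<le> ?K n Q"
        by (simp add: Q entropy_term_eq p_def q_def)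
    qed
  qed
  then show ?thesis unfolding t_entropy_def by simp
qed

end

section \<open>The essential set\<close>

lemma invariant_measuresD:
  assumes "\<mu> \<in> invariant_measures X \<alpha>"
  shows "regular_borel_measure X \<mu>" "prob_space \<mu>" "sets \<mu> = sets (borel_of X)" "space \<mu> = topspace X"
    "B \<in> sets (borel_of X) \<Longrightarrow> emeasure \<mu> (\<alpha> -` B \<inter> topspace X) = emeasure \<mu> B"
proof -
  show 1: "regular_borel_measure X \<mu>" "prob_space \<mu>" "sets \<mu> = sets (borel_of X)"
    using assms regular_measure_finite(2)[of X \<mu>] unfolding invariant_measures_def by blast+
  show "space \<mu> = topspace X" using sets_eq_imp_space_eq[OF 1(3)] by simp
  show "B \<in> sets (borel_of X) \<Longrightarrow> emeasure \<mu> (\<alpha> -` B \<inter> topspace X) = emeasure \<mu> B"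
    using assms 1(3) unfolding invariant_measures_def by blast
qed

text \<open>The complement is the union of all open sets that are null for every invariant
  measure.\<close>

lemma essential_set_closed: "closedin X (essential_set X \<alpha>)"
proof -
  let ?N = "{V. openin X V \<and> (\<forall>\<mu>\<in>invariant_measures X \<alpha>. emeasure \<mu> V = 0)}"
  have "topspace X - essential_set X \<alpha> = \<Union>?N"
    using openin_subset[of X] by (fastforce simp: essential_set_def zero_less_iff_neq_zero)
  then have "openin X (topspace X - essential_set X \<alpha>)" by auto
  then show ?thesis by (auto simp: closedin_def essential_set_def)
qed

text \<open>The preimage of a neighborhood of \<open>\<alpha> x\<close> is a neighborhood of
  \<open>x\<close>, and an invariant measure gives both the same mass.\<close>

lemma essential_set_forward:
  assumes cont: "continuous_map X X \<alpha>"
  shows "\<alpha> ` essential_set X \<alpha> \<subseteq> essential_set X \<alpha>"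
proof
  fix y assume "y \<in> \<alpha> ` essential_set X \<alpha>"
  then obtain x where x: "x \<in> essential_set X \<alpha>" "y = \<alpha> x" by auto
  have xX: "x \<in> topspace X" "y \<in> topspace X"
    using x cont by (auto simp: essential_set_def continuous_map_def)
  show "y \<in> essential_set X \<alpha>"
    unfolding essential_set_def
  proof (intro CollectI conjI allI impI)
    fix V assume V: "openin X V \<and> y \<in> V"
    have "openin X {z \<in> topspace X. \<alpha> z \<in> V}"
      using V cont openin_continuous_map_preimage by blast
    then obtain \<mu> where \<mu>: "\<mu> \<in> invariant_measures X \<alpha>" "emeasure \<mu> {z \<in> topspace X. \<alpha> z \<in> V} > 0"
      using x V xX by (auto simp: essential_set_def)
    have "{z \<in> topspace X. \<alpha> z \<in> V} = \<alpha> -` V \<inter> topspace X" by auto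
    then show "\<exists>\<mu>\<in>invariant_measures X \<alpha>. emeasure \<mu> V > 0"
      using \<mu> V invariant_measuresD(5)[OF \<mu>(1)] by (auto simp: openin_borel_of)
  qed (rule xX)
qed

text \<open>The complement is a possibly uncountable union of null open sets, so countable
  additivity alone is not enough. A compact subset is covered by finitely many of them, hence null,
  and inner regularity concludes.\<close>

lemma emeasure_inessential:
  assumes \<mu>: "\<mu> \<in> invariant_measures X \<alpha>"
  shows "emeasure \<mu> (topspace X - essential_set X \<alpha>) = 0"
proof -
  note D = invariant_measuresD[OF \<mu>]
  let ?N = "topspace X - essential_set X \<alpha>"
  have N: "?N \<in> sets \<mu>"
    using essential_set_closed[of X \<alpha>] by (auto simp: D(3) closedin_def openin_borel_of)
  have "emeasure \<mu> K = 0" if K: "compactin X K" "K \<subseteq> ?N" for K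
  proof -
    let ?U = "{V. openin X V \<and> emeasure \<mu> V = 0}"
    have "K \<subseteq> \<Union>?U"
      using K(2) \<mu> by (force simp: essential_set_def zero_less_iff_neq_zero)
    then obtain F where F: "finite F" "F \<subseteq> ?U" "K \<subseteq> \<Union>F"
      using compactinD[OF K(1), of ?U] by auto
    have "(\<Union>V\<in>F. V) \<in> null_sets \<mu>"
      using F by (intro null_sets_UN') (auto simp: null_sets_def D(3) openin_borel_of countable_finite)
    then have null: "\<Union>F \<in> null_sets \<mu>" by simp
    show ?thesis
      using emeasure_mono[OF F(3) null_setsD2[OF null]] by (simp add: null_setsD1[OF null])
  qed
  then have "(SUP K\<in>{K. compactin X K \<and> K \<subseteq> ?N}. emeasure \<mu> K) \<le> 0"
    by (intro SUP_least) auto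
  moreover have "emeasure \<mu> ?N = (SUP K\<in>{K. compactin X K \<and> K \<subseteq> ?N}. emeasure \<mu> K)"
    using D(1) N unfolding regular_borel_measure_def by blast
  ultimately show ?thesis by simp
qed

section \<open>Restricting measures to a closed set and extending them back\<close>

lemma sets_borel_of_subtopology:
  assumes "closedin X Y" "sets \<mu> = sets (borel_of X)"
  shows "sets (restrict_space \<mu> Y) = sets (borel_of (subtopology X Y))"
proof -
  have Y: "Y \<subseteq> topspace X" using assms(1) by (rule closedin_subset)
  have "sets (restrict_space \<mu> Y) = (\<inter>) Y ` sigma_sets (topspace X) {U. openin X U}"
    by (simp add: sets_restrict_space assms(2) sets_borel_of)
  also have "\<dots> = sigma_sets Y ((\<inter>) Y ` {U. openin X U})"
    using closedin_borel_of[OF assms(1)] Y by (intro sigma_sets_Int) (simp_all add: sets_borel_of)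
  also have "(\<inter>) Y ` {U. openin X U} = {U. openin (subtopology X Y) U}"
    by (auto simp: openin_subtopology Int_commute)
  finally show ?thesis using Y by (simp add: sets_borel_of Int_absorb1)
qed

text \<open>The sets \<open>B\<close> and \<open>B \<inter> Y\<close> differ only within the null
  set \<open>topspace X - Y\<close>.\<close>

lemma extend_restrict_space:
  assumes "closedin X Y" "sets \<mu> = sets (borel_of X)" "emeasure \<mu> (topspace X - Y) = 0"
  shows "extend_measure_to X (restrict_space \<mu> Y) = \<mu>"
  unfolding extend_measure_to_def
proof (rule measure_eqI)
  have Y: "Y \<in> sets \<mu>" "Y \<subseteq> topspace X"
    using assms(1,2) by (auto simp: closedin_borel_of closedin_subset)
  have space: "space \<mu> = topspace X" using sets_eq_imp_space_eq[OF assms(2)] by simp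
  show "sets (distr (restrict_space \<mu> Y) (borel_of X) (\<lambda>x. x)) = sets \<mu>"
    by (simp add: assms(2))
  fix B assume "B \<in> sets (distr (restrict_space \<mu> Y) (borel_of X) (\<lambda>x. x))"
  then have B: "B \<in> sets (borel_of X)" by simp
  have meas: "(\<lambda>x. x) \<in> restrict_space \<mu> Y \<rightarrow>\<^sub>M borel_of X"
    by (intro measurable_restrict_space1) (simp add: measurable_cong_sets[OF assms(2) refl])
  have "emeasure (distr (restrict_space \<mu> Y) (borel_of X) (\<lambda>x. x)) B = emeasure (restrict_space \<mu> Y) (B \<inter> Y)"
    using meas B Y space by (subst emeasure_distr) (auto simp: space_restrict_space Int_absorb2 Int_commute)
  also have "\<dots> = emeasure \<mu> (B \<inter> Y)"
    using Y space by (intro emeasure_restrict_space) (auto simp: Int_absorb2)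
  also have "\<dots> = emeasure \<mu> B"
  proof (rule emeasure_eq_AE)
    have "topspace X - Y \<in> null_sets \<mu>"
      using assms(3) sets.compl_sets[OF Y(1)] space by (simp add: null_sets_def)
    then show "AE x in \<mu>. x \<in> B \<inter> Y \<longleftrightarrow> x \<in> B"
      by (rule AE_I') (auto simp: space)
  qed (use B Y assms(2) in auto)
  finally show "emeasure (distr (restrict_space \<mu> Y) (borel_of X) (\<lambda>x. x)) B = emeasure \<mu> B" .
qed

lemma prob_space_restrict_full:
  assumes "prob_space \<mu>" "Y \<in> sets \<mu>" "emeasure \<mu> (space \<mu> - Y) = 0"
  shows "prob_space (restrict_space \<mu> Y)"
proof
  interpret prob_space \<mu> by fact
  have Y: "Y \<subseteq> space \<mu>" using assms(2) by (rule sets.sets_into_space)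
  have "emeasure \<mu> (space \<mu>) = emeasure \<mu> Y + emeasure \<mu> (space \<mu> - Y)"
    using assms(2) Y by (subst plus_emeasure) (auto simp: Un_absorb1)
  then show "emeasure (restrict_space \<mu> Y) (space (restrict_space \<mu> Y)) = 1"
    using assms Y by (simp add: emeasure_restrict_space space_restrict_space emeasure_space_1 Int_absorb2)
qed

section \<open>Entropy on forward invariant closed sets and on the essential set\<close>

theorem theorem4:
  fixes X :: "'a topology" and \<alpha> :: "'a \<Rightarrow> 'a" and A :: "('a \<Rightarrow> real) \<Rightarrow> 'a \<Rightarrow> real"
  assumes "compact_space X" and "Hausdorff_space X" and "topspace X \<noteq> {}"
    and "continuous_map X X \<alpha>"
    and "transfer_operator X \<alpha> A"
  shows "(\<forall>Y. closedin X Y \<and> \<alpha> ` Y \<subseteq> Y \<and> compatible X A Y \<longrightarrow>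
            (\<forall>\<mu>\<in>invariant_measures (subtopology X Y) \<alpha>.
               t_entropy X A (extend_measure_to X \<mu>)
                 = t_entropy (subtopology X Y) (trace_operator X A Y) \<mu>)) \<and>
         (compatible X A (essential_set X \<alpha>) \<longrightarrow>
            (\<forall>\<mu>\<in>invariant_measures X \<alpha>.
               t_entropy X A \<mu>
                 = t_entropy (subtopology X (essential_set X \<alpha>))
                     (trace_operator X A (essential_set X \<alpha>))
                     (restrict_space \<mu> (essential_set X \<alpha>))))"
proof -
  have trans: "compatible_transfer X A Y \<alpha>"
    if "closedin X Y" "\<alpha> ` Y \<subseteq> Y" "compatible X A Y" for Y
    using that assms by unfold_locales (auto simp: transfer_operator_def)
  show ?thesis
  proof (intro conjI allI impI ballI)
    fix Y \<mu>
    assume Y: "closedin X Y \<and> \<alpha> ` Y \<subseteq> Y \<and> compatible X A Y"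
      and \<mu>: "\<mu> \<in> invariant_measures (subtopology X Y) \<alpha>"
    interpret compatible_transfer X A Y \<alpha> using Y trans by blast
    show "t_entropy X A (extend_measure_to X \<mu>) = t_entropy (subtopology X Y) (trace_operator X A Y) \<mu>"
      by (rule t_entropy_trace) (rule invariant_measuresD[OF \<mu>])+
  next
    fix \<mu> assume compat: "compatible X A (essential_set X \<alpha>)" and \<mu>: "\<mu> \<in> invariant_measures X \<alpha>"
    let ?E = "essential_set X \<alpha>"
    note D = invariant_measuresD[OF \<mu>] and closed = essential_set_closed[of X \<alpha>]
    interpret compatible_transfer X A ?E \<alpha>
      using trans closed essential_set_forward[OF assms(4)] compat by blast
    \<comment> \<open>The comparison is applied to the restriction of \<open>\<mu>\<close>; its
      extension to \<open>X\<close> is \<open>\<mu>\<close> again, because the complement of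
      \<open>?E\<close> is null.\<close>
    have "t_entropy X A (extend_measure_to X (restrict_space \<mu> ?E))
      = t_entropy (subtopology X ?E) (trace_operator X A ?E) (restrict_space \<mu> ?E)"
    proof (rule t_entropy_trace)
      show "prob_space (restrict_space \<mu> ?E)"
        using closed emeasure_inessential[OF \<mu>] by (intro prob_space_restrict_full D(2)) (auto simp: D closedin_borel_of)
    qed (rule sets_borel_of_subtopology[OF closed D(3)])
    then show "t_entropy X A \<mu> = t_entropy (subtopology X ?E) (trace_operator X A ?E) (restrict_space \<mu> ?E)"
      by (simp only: extend_restrict_space[OF closed D(3) emeasure_inessential[OF \<mu>]])
  qed
qed

end
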